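(* Let $\varphi\in C(\overline{\mathbb D})\cap AQ(\mathbb D)$ satisfy $\operatorname{Re}\varphi(z)\ge|\operatorname{Im}\varphi(z)|^2$ for all $z\in\mathbb D$. Then the Toeplitz operator $T_\varphi$ is invertible on $A^2$ if and only if it is a Fredholm operator.
   Context: $\mathbb D$ is the open unit disc, $dA$ normalized area measure, $A^2$ the Bergman space of analytic functions in $L^2(\mathbb D,dA)$, $P$ the orthogonal projection $L^2\to A^2$, and $T_\varphi f=P(\varphi f)$ on $A^2$. $AQ(\mathbb D)$ denotes the closed subalgebra of $L^\infty(\mathbb D)$ consisting of those $\psi$ for which the Hankel operator $H_\psi=(I-P)M_\psi:A^2\to L^2$ is compact, where $M_\psi f=\psi f$. *)

theory Defs
  imports "HOL-Analysis.Analysis" "HOL-Complex_Analysis.Complex_Analysis"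
begin

definition disc :: "complex set" where
  "disc = ball 0 1"

text \<open>L^2(D, dA), dA = normalized area measure (Lebesgue measure / pi).
  Elements are represented by functions; only their values on the disc matter
  (and only up to null sets).\<close>
definition L2 :: "(complex \<Rightarrow> complex) set" where
  "L2 = {f. set_borel_measurable lborel disc f \<and>
            set_integrable lborel disc (\<lambda>z. (cmod (f z))\<^sup>2)}"

definition l2_inner :: "(complex \<Rightarrow> complex) \<Rightarrow> (complex \<Rightarrow> complex) \<Rightarrow> complex" where
  "l2_inner f g = complex_of_real (1 / pi) * (LINT z:disc|lborel. f z * cnj (g z))"

definition l2_norm :: "(complex \<Rightarrow> complex) \<Rightarrow> real" where
  "l2_norm f = sqrt ((1 / pi) * (LINT z:disc|lborel. (cmod (f z))\<^sup>2))"

definition A2 :: "(complex \<Rightarrow> complex) set" where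
  "A2 = {f \<in> L2. f holomorphic_on disc}"

definition Linf :: "(complex \<Rightarrow> complex) set" where
  "Linf = {\<psi>. set_borel_measurable lborel disc \<psi> \<and>
              (\<exists>C. AE z in lborel. z \<in> disc \<longrightarrow> cmod (\<psi> z) \<le> C)}"

definition bergman_proj :: "(complex \<Rightarrow> complex) \<Rightarrow> (complex \<Rightarrow> complex)" where
  "bergman_proj g = (SOME h. h \<in> A2 \<and> (\<forall>k\<in>A2. l2_inner (\<lambda>z. g z - h z) k = 0))"

definition toeplitz :: "(complex \<Rightarrow> complex) \<Rightarrow> (complex \<Rightarrow> complex) \<Rightarrow> (complex \<Rightarrow> complex)" where
  "toeplitz \<phi> f = bergman_proj (\<lambda>z. \<phi> z * f z)"

definition hankel :: "(complex \<Rightarrow> complex) \<Rightarrow> (complex \<Rightarrow> complex) \<Rightarrow> (complex \<Rightarrow> complex)" where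
  "hankel \<psi> f = (\<lambda>z. \<psi> z * f z - bergman_proj (\<lambda>z. \<psi> z * f z) z)"

definition compact_op_A2_L2 :: "((complex \<Rightarrow> complex) \<Rightarrow> (complex \<Rightarrow> complex)) \<Rightarrow> bool" where
  "compact_op_A2_L2 H \<longleftrightarrow>
     (\<forall>f :: nat \<Rightarrow> complex \<Rightarrow> complex. (\<forall>n. f n \<in> A2 \<and> l2_norm (f n) \<le> 1) \<longrightarrow>
        (\<exists>r g. strict_mono r \<and> g \<in> L2 \<and>
               (\<lambda>n. l2_norm (\<lambda>z. H (f (r n)) z - g z)) \<longlonglongrightarrow> 0))"

definition AQ :: "(complex \<Rightarrow> complex) set" where
  "AQ = {\<psi> \<in> Linf. compact_op_A2_L2 (hankel \<psi>)}"

text \<open>Invertibility in B(A^2): a bounded linear two-sided inverse on A^2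
  (elements of A^2 identified when they agree on the disc).\<close>
definition invertible_A2 :: "((complex \<Rightarrow> complex) \<Rightarrow> (complex \<Rightarrow> complex)) \<Rightarrow> bool" where
  "invertible_A2 T \<longleftrightarrow>
     (\<exists>S. (\<forall>g\<in>A2. S g \<in> A2)
        \<and> (\<forall>g1\<in>A2. \<forall>g2\<in>A2. (\<forall>z\<in>disc. g1 z = g2 z) \<longrightarrow> (\<forall>z\<in>disc. S g1 z = S g2 z))
        \<and> (\<forall>g1\<in>A2. \<forall>g2\<in>A2. \<forall>c. \<forall>z\<in>disc.
              S (\<lambda>w. c * g1 w + g2 w) z = c * S g1 z + S g2 z)
        \<and> (\<exists>C. \<forall>g\<in>A2. l2_norm (S g) \<le> C * l2_norm g)
        \<and> (\<forall>f\<in>A2. \<forall>z\<in>disc. S (T f) z = f z)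
        \<and> (\<forall>g\<in>A2. \<forall>z\<in>disc. T (S g) z = g z))"

definition fredholm_A2 :: "((complex \<Rightarrow> complex) \<Rightarrow> (complex \<Rightarrow> complex)) \<Rightarrow> bool" where
  "fredholm_A2 T \<longleftrightarrow>
     (\<forall>(f :: nat \<Rightarrow> complex \<Rightarrow> complex) g. (\<forall>n. f n \<in> A2) \<and> g \<in> A2 \<and>
         (\<lambda>n. l2_norm (\<lambda>z. T (f n) z - g z)) \<longlonglongrightarrow> 0 \<longrightarrow>
         (\<exists>h\<in>A2. \<forall>z\<in>disc. T h z = g z))
   \<and> (\<exists>B. finite B \<and> B \<subseteq> {f \<in> A2. \<forall>z\<in>disc. T f z = 0} \<and>
         (\<forall>f\<in>A2. (\<forall>z\<in>disc. T f z = 0) \<longrightarrow>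
            (\<exists>c. \<forall>z\<in>disc. f z = (\<Sum>b\<in>B. c b * b z))))
   \<and> (\<exists>B. finite B \<and> B \<subseteq> A2 \<and>
         (\<forall>g\<in>A2. \<exists>f\<in>A2. \<exists>c. \<forall>z\<in>disc. g z = T f z + (\<Sum>b\<in>B. c b * b z)))"

end

theory Submission
  imports Defs "HOL-Library.Function_Algebras"
begin

text \<open>
  For \<open>f\<close> in the Bergman space, \<open>Re \<langle>T\<^sub>\<phi> f, f\<rangle>\<close> is the integral of \<open>Re \<phi> |f|\<^sup>2\<close>. If \<open>\<langle>T\<^sub>\<phi> f, f\<rangle> = 0\<close>,
  then \<open>Re \<phi>\<close>, and with it \<open>Im \<phi>\<close>, vanishes wherever \<open>f\<close> does not; so \<open>f = 0\<close> by the identity theorem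
  unless \<open>\<phi> = 0\<close>, which Fredholmness excludes because the Bergman space is infinite-dimensional.
  Hence a closed range of \<open>T\<^sub>\<phi>\<close> is everything: the component \<open>u\<close> of any function orthogonal to the
  range satisfies \<open>\<langle>T\<^sub>\<phi> u, u\<rangle> = 0\<close>. The uniform boundedness principle turns surjectivity of \<open>T\<^sub>\<phi>\<close>
  into a lower bound for its adjoint, the Toeplitz operator with symbol \<open>cnj \<phi>\<close>, which satisfies the
  same hypotheses and is therefore also surjective; exchanging the two gives a lower bound for \<open>T\<^sub>\<phi>\<close>.
\<close>

section \<open>The space of square-integrable functions\<close>

text \<open>Plain Lebesgue measure on the disc; the normalizing factor \<open>1 / pi\<close> stays
  explicit in \<open>l2_inner\<close> and \<open>l2_norm\<close>. With a restricted space, set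
  integrals become ordinary integrals.\<close>

abbreviation disc_measure :: "complex measure" where
  "disc_measure \<equiv> restrict_space lborel disc"

lemma open_disc: "open disc" and connected_disc: "connected disc" and zero_in_disc: "0 \<in> disc"
  by (auto simp: disc_def)

lemma disc_sets [measurable]: "disc \<in> sets borel"
  by (auto simp: disc_def)

lemma space_disc_measure [simp]: "space disc_measure = disc"
  by (simp add: space_restrict_space)

lemma finite_disc_measure: "finite_measure disc_measure"
  using emeasure_lborel_ball_finite[of "0::complex" 1]
  by (intro finite_measureI) (simp add: emeasure_restrict_space disc_def less_top)

lemma continuous_measurable_disc:
  assumes "continuous_on disc f" shows "f \<in> borel_measurable disc_measure"
  using borel_measurable_continuous_on_restrict[OF assms]
  by (simp add: measurable_def sets_restrict_space space_restrict_space)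

lemma L2_iff: "f \<in> L2 \<longleftrightarrow> f \<in> borel_measurable disc_measure \<and> integrable disc_measure (\<lambda>z. (cmod (f z))\<^sup>2)"
  by (simp add: L2_def set_borel_measurable_def set_integrable_def
      borel_measurable_restrict_space_iff integrable_restrict_space)

lemma l2_inner_eq: "l2_inner f g = complex_of_real (1 / pi) * (\<integral>z. f z * cnj (g z) \<partial>disc_measure)"
  by (simp add: l2_inner_def set_lebesgue_integral_def integral_restrict_space)

lemma l2_norm_eq: "l2_norm f = sqrt ((1 / pi) * (\<integral>z. (cmod (f z))\<^sup>2 \<partial>disc_measure))"
  by (simp add: l2_norm_def set_lebesgue_integral_def integral_restrict_space)

lemma cmod_lincomb_sq: "(cmod (c * x + y))\<^sup>2 \<le> 2 * (cmod c)\<^sup>2 * (cmod x)\<^sup>2 + 2 * (cmod y)\<^sup>2"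
proof -
  have "cmod (c * x + y) \<le> cmod c * cmod x + cmod y"
    by (metis norm_mult norm_triangle_ineq)
  then have "(cmod (c * x + y))\<^sup>2 \<le> (cmod c * cmod x + cmod y)\<^sup>2"
    by (simp add: power_mono)
  also have "\<dots> \<le> 2 * (cmod c)\<^sup>2 * (cmod x)\<^sup>2 + 2 * (cmod y)\<^sup>2"
    using sum_squares_bound[of "cmod c * cmod x" "cmod y"]
    by (simp add: power2_sum power_mult_distrib)
  finally show ?thesis .
qed

lemma L2_lincomb:
  assumes "f \<in> L2" "g \<in> L2" shows "(\<lambda>z. c * f z + g z) \<in> L2"
proof -
  have m: "f \<in> borel_measurable disc_measure" "g \<in> borel_measurable disc_measure"
    and i: "integrable disc_measure (\<lambda>z. (cmod (f z))\<^sup>2)" "integrable disc_measure (\<lambda>z. (cmod (g z))\<^sup>2)"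
    using assms by (auto simp: L2_iff)
  have "integrable disc_measure (\<lambda>z. 2 * (cmod c)\<^sup>2 * (cmod (f z))\<^sup>2 + 2 * (cmod (g z))\<^sup>2)"
    using i by auto
  then have "integrable disc_measure (\<lambda>z. (cmod (c * f z + g z))\<^sup>2)"
    by (rule Bochner_Integration.integrable_bound) (use m cmod_lincomb_sq in auto)
  then show ?thesis
    using m by (auto simp: L2_iff)
qed

lemma L2_zero: "(\<lambda>z. 0) \<in> L2"
  by (auto simp: L2_iff)

lemma L2_scale: "f \<in> L2 \<Longrightarrow> (\<lambda>z. c * f z) \<in> L2"
  using L2_lincomb[of f "\<lambda>z. 0" c] L2_zero by simp

lemma L2_diff: "f \<in> L2 \<Longrightarrow> g \<in> L2 \<Longrightarrow> (\<lambda>z. f z - g z) \<in> L2"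
  using L2_lincomb[of g f "-1"] by simp

lemma L2_mult_bounded:
  assumes "f \<in> L2" "\<phi> \<in> borel_measurable disc_measure" "\<And>z. z \<in> disc \<Longrightarrow> cmod (\<phi> z) \<le> B"
  shows "(\<lambda>z. \<phi> z * f z) \<in> L2"
proof -
  have m: "f \<in> borel_measurable disc_measure" and i: "integrable disc_measure (\<lambda>z. (cmod (f z))\<^sup>2)"
    using assms by (auto simp: L2_iff)
  have "integrable disc_measure (\<lambda>z. B\<^sup>2 * (cmod (f z))\<^sup>2)"
    using i by auto
  then have "integrable disc_measure (\<lambda>z. (cmod (\<phi> z * f z))\<^sup>2)"
  proof (rule Bochner_Integration.integrable_bound)
    show "AE z in disc_measure. norm ((cmod (\<phi> z * f z))\<^sup>2) \<le> norm (B\<^sup>2 * (cmod (f z))\<^sup>2)"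
      by (rule AE_I2) (use assms(3) in \<open>auto simp: norm_mult power_mult_distrib intro!: mult_right_mono power_mono\<close>)
  qed (use m assms(2) in auto)
  then show ?thesis
    using m assms(2) by (auto simp: L2_iff)
qed

lemma L2_integrable_inner:
  assumes "f \<in> L2" "g \<in> L2" shows "integrable disc_measure (\<lambda>z. f z * cnj (g z))"
proof -
  have m: "f \<in> borel_measurable disc_measure" "g \<in> borel_measurable disc_measure"
    and i: "integrable disc_measure (\<lambda>z. (cmod (f z))\<^sup>2 + (cmod (g z))\<^sup>2)"
    using assms by (auto simp: L2_iff)
  have "cmod (f z) * cmod (g z) \<le> (cmod (f z))\<^sup>2 + (cmod (g z))\<^sup>2" for z
    using sum_squares_bound[of "cmod (f z)" "cmod (g z)"] mult_nonneg_nonneg[OF norm_ge_zero norm_ge_zero, of "f z" "g z"]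
    by linarith
  moreover have "(\<lambda>z. f z * cnj (g z)) \<in> borel_measurable disc_measure"
    by (intro borel_measurable_times m borel_measurable_continuous_on[OF _ m(2)]) (rule continuous_on_cnj[OF continuous_on_id])
  ultimately show ?thesis
    by (intro Bochner_Integration.integrable_bound[OF i]) (auto simp: norm_mult)
qed

lemma l2_inner_lincomb_left:
  assumes "f \<in> L2" "g \<in> L2" "h \<in> L2"
  shows "l2_inner (\<lambda>z. c * f z + g z) h = c * l2_inner f h + l2_inner g h"
proof -
  have "(\<integral>z. (c * f z + g z) * cnj (h z) \<partial>disc_measure)
     = (\<integral>z. c * (f z * cnj (h z)) + g z * cnj (h z) \<partial>disc_measure)"
    by (simp add: algebra_simps)
  also have "\<dots> = c * (\<integral>z. f z * cnj (h z) \<partial>disc_measure) + (\<integral>z. g z * cnj (h z) \<partial>disc_measure)"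
    using assms by (subst Bochner_Integration.integral_add) (auto intro!: L2_integrable_inner)
  finally show ?thesis
    by (simp add: l2_inner_eq algebra_simps)
qed

lemma l2_inner_commute: "l2_inner g f = cnj (l2_inner f g)"
  using Bochner_Integration.integral_cnj[of disc_measure "\<lambda>z. f z * cnj (g z)"] by (simp add: l2_inner_eq mult.commute)

lemma l2_inner_diff_left:
  assumes "f \<in> L2" "g \<in> L2" "h \<in> L2"
  shows "l2_inner (\<lambda>z. f z - g z) h = l2_inner f h - l2_inner g h"
  using l2_inner_lincomb_left[of g f h "-1"] assms by simp

lemma l2_inner_self: "l2_inner f f = complex_of_real ((l2_norm f)\<^sup>2)"
proof -
  have "(\<integral>z. f z * cnj (f z) \<partial>disc_measure) = complex_of_real (\<integral>z. (cmod (f z))\<^sup>2 \<partial>disc_measure)"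
    by (simp only: complex_norm_square[symmetric] integral_complex_of_real)
  then show ?thesis
    by (simp add: l2_inner_eq l2_norm_eq)
qed

lemma l2_norm_nonneg [simp]: "l2_norm f \<ge> 0"
  by (simp add: l2_norm_eq)

lemma l2_inner_cong:
  "(\<And>z. z \<in> disc \<Longrightarrow> f z = f' z) \<Longrightarrow> (\<And>z. z \<in> disc \<Longrightarrow> g z = g' z) \<Longrightarrow> l2_inner f g = l2_inner f' g'"
  unfolding l2_inner_eq
  by (intro arg_cong[where f = "\<lambda>x. _ * x"] Bochner_Integration.integral_cong) auto

lemma l2_norm_cong:
  "(\<And>z. z \<in> disc \<Longrightarrow> f z = f' z) \<Longrightarrow> l2_norm f = l2_norm f'"
  unfolding l2_norm_eq
  by (intro arg_cong[where f = "\<lambda>x. sqrt (_ * x)"] Bochner_Integration.integral_cong) auto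

text \<open>The expansion behind all the Hilbert space geometry below: Cauchy-Schwarz, the triangle
  inequality, the parallelogram law and the variational argument for projections.\<close>

lemma l2_norm_lincomb_sq:
  assumes "f \<in> L2" "g \<in> L2"
  shows "(l2_norm (\<lambda>z. c * f z + g z))\<^sup>2
    = (cmod c)\<^sup>2 * (l2_norm f)\<^sup>2 + 2 * Re (c * l2_inner f g) + (l2_norm g)\<^sup>2"
proof -
  let ?h = "\<lambda>z. c * f z + g z"
  have h: "?h \<in> L2"
    using assms by (rule L2_lincomb)
  have "l2_inner ?h ?h = c * cnj (l2_inner ?h f) + cnj (l2_inner ?h g)"
    by (subst l2_inner_lincomb_left[OF assms h]) (simp add: l2_inner_commute[of _ ?h])
  also have "\<dots> = c * cnj (c * l2_inner f f + l2_inner g f) + cnj (c * l2_inner f g + l2_inner g g)"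
    using assms by (simp add: l2_inner_lincomb_left)
  also have "\<dots> = c * cnj c * l2_inner f f + (c * l2_inner f g + cnj (c * l2_inner f g)) + l2_inner g g"
    by (simp add: l2_inner_self l2_inner_commute[of g f] algebra_simps)
  finally have "Re (l2_inner ?h ?h) = Re (c * cnj c * l2_inner f f + (c * l2_inner f g + cnj (c * l2_inner f g)) + l2_inner g g)"
    by simp
  then show ?thesis
    by (simp only: l2_inner_self complex_norm_square[symmetric] complex_add_cnj of_real_mult[symmetric] of_real_add[symmetric] Re_complex_of_real plus_complex.sel)
qed

lemma l2_norm_scale:
  "l2_norm (\<lambda>z. c * f z) = cmod c * l2_norm f"
  by (simp add: l2_norm_eq norm_mult power_mult_distrib real_sqrt_mult real_sqrt_divide)

lemma l2_norm_minus_commute: "l2_norm (\<lambda>z. f z - g z) = l2_norm (\<lambda>z. g z - f z)"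
  by (simp add: l2_norm_eq norm_minus_commute)

lemma l2_cauchy_schwarz:
  assumes "f \<in> L2" "g \<in> L2"
  shows "cmod (l2_inner f g) \<le> l2_norm f * l2_norm g"
proof -
  let ?a = "l2_inner f g" let ?F = "(l2_norm f)\<^sup>2" let ?G = "(l2_norm g)\<^sup>2"
  \<comment> \<open>The coefficient \<open>- t * cnj ?a\<close> makes the cross term real and
    negative, so the expanded square is a quadratic polynomial in \<open>t\<close>.\<close>
  have *: "0 \<le> t\<^sup>2 * (cmod ?a)\<^sup>2 * ?F - 2 * t * (cmod ?a)\<^sup>2 + ?G" for t :: real
  proof -
    have "(- complex_of_real t * cnj ?a) * ?a = - complex_of_real (t * (cmod ?a)\<^sup>2)"
      by (simp only: of_real_mult complex_norm_square) (simp add: algebra_simps)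
    then have "Re ((- complex_of_real t * cnj ?a) * ?a) = - (t * (cmod ?a)\<^sup>2)"
      by (metis Re_complex_of_real uminus_complex.sel(1))
    then have "(l2_norm (\<lambda>z. (- complex_of_real t * cnj ?a) * f z + g z))\<^sup>2
      = t\<^sup>2 * (cmod ?a)\<^sup>2 * ?F - 2 * t * (cmod ?a)\<^sup>2 + ?G"
      using l2_norm_lincomb_sq[OF assms, of "- complex_of_real t * cnj ?a"]
      by (simp add: norm_mult power_mult_distrib)
    then show ?thesis
      by (metis zero_le_power2)
  qed
  have "(cmod ?a)\<^sup>2 \<le> ?F * ?G"
  proof (cases "?F = 0")
    \<comment> \<open>The polynomial is now affine in \<open>t\<close>; if \<open>?a\<close> were
      nonzero, the chosen \<open>t\<close> would give it the value -1.\<close>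
    case True
    show ?thesis
    proof (rule ccontr)
      assume "\<not> ?thesis"
      then have "(cmod ?a)\<^sup>2 > 0" using True by simp
      moreover from this have "2 * ((?G + 1) / (2 * (cmod ?a)\<^sup>2)) * (cmod ?a)\<^sup>2 = ?G + 1"
        by simp
      ultimately show False
        using *[of "(?G + 1) / (2 * (cmod ?a)\<^sup>2)"] True by simp
    qed
  next
    \<comment> \<open>Here \<open>t = 1 / ?F\<close> minimizes the polynomial.\<close>
    case False
    then have "?F > 0" by simp
    moreover have "(1 / ?F)\<^sup>2 * (cmod ?a)\<^sup>2 * ?F = (cmod ?a)\<^sup>2 / ?F"
      using False by (simp add: power2_eq_square)
    ultimately have "(cmod ?a)\<^sup>2 / ?F \<le> ?G"
      using *[of "1 / ?F"] by simp
    with \<open>?F > 0\<close> show ?thesis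
      by (simp add: pos_divide_le_eq mult.commute)
  qed
  then show ?thesis
    using power2_le_imp_le[of "cmod ?a" "l2_norm f * l2_norm g"] by (simp add: power_mult_distrib)
qed

lemma l2_norm_triangle:
  assumes "f \<in> L2" "g \<in> L2"
  shows "l2_norm (\<lambda>z. f z + g z) \<le> l2_norm f + l2_norm g"
proof -
  have "(l2_norm (\<lambda>z. f z + g z))\<^sup>2 = (l2_norm f)\<^sup>2 + 2 * Re (l2_inner f g) + (l2_norm g)\<^sup>2"
    using l2_norm_lincomb_sq[OF assms, of 1] by simp
  also have "\<dots> \<le> (l2_norm f + l2_norm g)\<^sup>2"
    using l2_cauchy_schwarz[OF assms] complex_Re_le_cmod[of "l2_inner f g"]
    by (simp add: power2_sum)
  finally show ?thesis
    by (rule power2_le_imp_le) simp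
qed

lemma l2_norm_triangle_diff:
  assumes "f \<in> L2" "g \<in> L2" "h \<in> L2"
  shows "l2_norm (\<lambda>z. f z - h z) \<le> l2_norm (\<lambda>z. f z - g z) + l2_norm (\<lambda>z. g z - h z)"
  using l2_norm_triangle[OF L2_diff[OF assms(1,2)] L2_diff[OF assms(2,3)]] by simp

section \<open>Area mean value property\<close>

definition vec2_complex :: "real^2 \<Rightarrow> complex" where
  "vec2_complex v = Complex (v$1) (v$2)"

definition complex_vec2 :: "complex \<Rightarrow> real^2" where
  "complex_vec2 z = (\<chi> i. if i = 1 then Re z else Im z)"

lemma vec2_complex_inverse [simp]: "complex_vec2 (vec2_complex v) = v"
  and complex_vec2_inverse [simp]: "vec2_complex (complex_vec2 z) = z"
  by (auto simp: vec2_complex_def complex_vec2_def vec_eq_iff forall_2)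

lemma measurable_vec2_complex [measurable]: "vec2_complex \<in> borel_measurable borel"
proof (rule borel_measurable_continuous_onI)
  have eq: "vec2_complex = (\<lambda>v. of_real (v$1) + \<i> * of_real (v$2))"
    by (simp add: fun_eq_iff vec2_complex_def complex_eq_iff)
  show "continuous_on UNIV vec2_complex"
    unfolding eq by (intro continuous_intros)
qed

lemma vec2_complex_vimage_box: "vec2_complex -` box l u = box (complex_vec2 l) (complex_vec2 u)"
  by (auto simp: box_def Basis_complex_def vec2_complex_def complex_vec2_def Basis_vec_def inner_axis UNIV_2)

text \<open>Two measures that agree with volume on boxes are Lebesgue measure. The coordinates carry
  questions about the complex plane to \<open>real^2\<close>, where orthogonal maps are known to
  preserve measure.\<close>

lemma lborel_complex_eq: "lborel = distr lborel borel vec2_complex"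
proof (rule lborel_eqI)
  fix l u :: complex
  assume le: "\<And>b. b \<in> Basis \<Longrightarrow> l \<bullet> b \<le> u \<bullet> b"
  have "emeasure (distr lborel borel vec2_complex) (box l u) = emeasure lborel (box (complex_vec2 l) (complex_vec2 u))"
    by (subst emeasure_distr) (auto simp: vec2_complex_vimage_box)
  also have "\<dots> = ennreal (\<Prod>b\<in>Basis. (complex_vec2 u - complex_vec2 l) \<bullet> b)"
    using le[of 1] le[of \<i>] by (intro emeasure_lborel_box)
      (auto simp: Basis_vec_def inner_axis UNIV_2 complex_vec2_def Basis_complex_def)
  also have "(\<Prod>b\<in>Basis. (complex_vec2 u - complex_vec2 l) \<bullet> b) = (\<Prod>b\<in>Basis. (u - l) \<bullet> b)"
    by (simp add: Basis_vec_def UNIV_2 axis_eq_axis inner_axis complex_vec2_def Basis_complex_def)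
  finally show "emeasure (distr lborel borel vec2_complex) (box l u) = ennreal (\<Prod>b\<in>Basis. (u - l) \<bullet> b)" .
qed simp

text \<open>In real coordinates, multiplication by a number of modulus 1 is an orthogonal
  transformation, so the preimage of a box has the measure of the box.\<close>

lemma lborel_distr_rotation:
  fixes c :: complex assumes c: "cmod c = 1"
  shows "distr lborel borel (\<lambda>w. c * w) = lborel"
proof (rule lborel_eqI[symmetric])
  fix l u :: complex
  assume le: "\<And>b. b \<in> Basis \<Longrightarrow> l \<bullet> b \<le> u \<bullet> b"
  \<comment> \<open>The inverse rotation: the preimage of a box under multiplication by
    \<open>c\<close> is the image of that box under \<open>R\<close>.\<close>
  define R where "R v = complex_vec2 (cnj c * vec2_complex v)" for v
  have cc: "cnj c * c = 1" 
    by (metis c complex_norm_square mult.commute of_real_1 power_one)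
  have "R = (\<lambda>v. \<chi> i. if i = 1 then Re c * v$1 + Im c * v$2 else Re c * v$2 - Im c * v$1)"
    by (auto simp: R_def fun_eq_iff complex_vec2_def vec2_complex_def vec_eq_iff)
  then have "linear R"
    by (auto intro!: linearI simp: vec_eq_iff algebra_simps)
  moreover have norm_eq: "norm (complex_vec2 z) = cmod z" for z
    by (simp add: norm_vec_def L2_set_def UNIV_2 complex_vec2_def cmod_def)
  have "norm (R v) = norm v" for v
    using norm_eq[of "cnj c * vec2_complex v"] norm_eq[of "vec2_complex v"] by (simp add: R_def norm_mult c)
  ultimately have R: "orthogonal_transformation R"
    by (simp add: orthogonal_transformation)
  let ?B = "box (complex_vec2 l) (complex_vec2 u)" and ?A = "(\<lambda>w. c * w) -` box l u"
  have A: "?A \<in> sets borel"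
    by (intro borel_open open_vimage[OF open_box] continuous_on_mult_left continuous_on_id)
  have im: "vec2_complex -` ?A = R ` ?B"
  proof -
    have "v \<in> R ` ?B" if "c * vec2_complex v \<in> box l u" for v
    proof (rule image_eqI)
      show "v = R (complex_vec2 (c * vec2_complex v))"
        by (simp add: R_def mult.assoc[symmetric] cc)
      show "complex_vec2 (c * vec2_complex v) \<in> ?B"
        using that by (simp add: vec2_complex_vimage_box[symmetric])
    qed
    moreover have "c * vec2_complex (R v) \<in> box l u" if "v \<in> ?B" for v
      using that by (simp add: vec2_complex_vimage_box[symmetric] R_def mult.assoc[symmetric] mult.commute[of c] cc)
    ultimately show ?thesis by auto
  qed
  have RB: "R ` ?B \<in> sets borel"
    using A measurable_sets[OF measurable_vec2_complex A] by (simp add: im)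
  have "emeasure (distr lborel borel (\<lambda>w. c * w)) (box l u) = emeasure lborel ?A"
    by (subst emeasure_distr) auto
  also have "\<dots> = emeasure (distr lborel borel vec2_complex) ?A"
    using lborel_complex_eq by simp
  also have "\<dots> = emeasure lborel (R ` ?B)"
    using A by (subst emeasure_distr) (auto simp: im)
  also have "\<dots> = emeasure lebesgue (R ` ?B)"
    using RB by simp
  also have "\<dots> = ennreal (measure lebesgue (R ` ?B))"
    using measurable_orthogonal_image[OF R, of ?B] by (simp add: emeasure_eq_measure2)
  also have "\<dots> = ennreal (measure lebesgue ?B)"
    by (simp add: measure_orthogonal_image[OF R])
  also have "\<dots> = emeasure lborel ?B"
    using emeasure_lborel_box_finite[of "complex_vec2 l" "complex_vec2 u"]
    by (simp add: emeasure_eq_ennreal_measure less_top)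
  also have "\<dots> = emeasure (distr lborel borel vec2_complex) (box l u)"
    by (subst emeasure_distr) (auto simp: vec2_complex_vimage_box)
  also have "\<dots> = ennreal (\<Prod>b\<in>Basis. (u - l) \<bullet> b)"
    using lborel_complex_eq emeasure_lborel_box[of l u] le by simp
  finally show "emeasure (distr lborel borel (\<lambda>w. c * w)) (box l u) = ennreal (\<Prod>b\<in>Basis. (u - l) \<bullet> b)" .
qed simp

text \<open>A rotation by the angle \<open>pi / n\<close> keeps the centred ball but changes the
  sign of the integrand, so the integral equals its own negative.\<close>

lemma integral_ball_power_eq_0:
  assumes "n > 0"
  shows "(\<integral>w. indicator (ball 0 s) w *\<^sub>R (w ^ n :: complex) \<partial>lborel) = 0" (is "?J = 0")
proof -
  define c where "c = cis (pi / n)"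
  have c: "cmod c = 1" "c ^ n = -1"
    using assms by (auto simp: c_def Complex.DeMoivre)
  have "?J = (\<integral>w. indicator (ball 0 s) w *\<^sub>R w ^ n \<partial>distr lborel borel (\<lambda>w. c * w))"
    by (simp add: lborel_distr_rotation c)
  also have "\<dots> = (\<integral>w. indicator (ball 0 s) (c * w) *\<^sub>R (c * w) ^ n \<partial>lborel)"
    by (intro integral_distr borel_measurable_continuous_on_indicator)
      (auto intro!: continuous_intros)
  also have "\<dots> = (\<integral>w. - (indicator (ball 0 s) w *\<^sub>R w ^ n) \<partial>lborel)"
    by (intro Bochner_Integration.integral_cong) (auto simp: indicator_def norm_mult c power_mult_distrib)
  also have "\<dots> = - ?J"
    by simp
  finally show ?thesis
    by simp
qed

text \<open>Integrate the Taylor series term by term; by the previous lemma only the constant term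
  survives.\<close>

lemma holomorphic_area_mean_value_0:
  assumes f: "f holomorphic_on ball 0 r" and s: "0 < s" "s < r"
  shows "(\<integral>w. indicator (ball 0 s) w *\<^sub>R f w \<partial>lborel) = measure lborel (ball (0::complex) s) *\<^sub>R f 0"
proof -
  define a where "a n = (deriv ^^ n) f 0 / fact n" for n
  have sums: "(\<lambda>n. a n * w ^ n) sums f w" if "w \<in> ball 0 r" for w
    using holomorphic_power_series[OF f that] by (simp add: a_def)
  \<comment> \<open>Convergence at a radius \<open>t\<close> beyond \<open>s\<close> yields absolute
    convergence at \<open>s\<close>, which dominates the series on the whole ball of radius
    \<open>s\<close>.\<close>
  obtain t where t: "s < t" "t < r"
    using dense s by blast
  have "summable (\<lambda>n. a n * of_real t ^ n)"
    using sums[of "of_real t"] s t by (auto simp: sums_iff)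
  then have sm: "summable (\<lambda>n. norm (a n * of_real s ^ n))"
    by (rule powser_insidea) (use s t in auto)
  let ?f = "\<lambda>n w. indicator (ball 0 s) w *\<^sub>R (a n * w ^ n)"
  have bound: "norm (?f n w) \<le> norm (a n * of_real s ^ n) * indicator (ball 0 s) w" for n w
    using s by (auto simp: indicator_def norm_mult norm_power intro!: mult_left_mono power_mono)
  have fin: "integrable lborel (\<lambda>w. indicator (ball (0::complex) s) w :: real)"
    using emeasure_lborel_ball_finite by (intro integrable_real_indicator) auto
  have int: "integrable lborel (?f n)" for n
    by (rule Bochner_Integration.integrable_bound[OF integrable_mult_right[OF fin, of "norm (a n * of_real s ^ n)"]])
      (use bound in \<open>auto intro!: AE_I2 borel_measurable_continuous_on_indicator continuous_intros\<close>)
  have sums': "(\<lambda>n. integral\<^sup>L lborel (?f n)) sums (\<integral>w. (\<Sum>n. ?f n w) \<partial>lborel)"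
  proof (rule sums_integral)
    show "AE w in lborel. summable (\<lambda>n. norm (?f n w))"
      using sm bound by (intro AE_I2 summable_comparison_test'[OF summable_mult2[OF sm]]) auto
    have "integral\<^sup>L lborel (\<lambda>w. norm (?f n w)) \<le> (\<integral>w. norm (a n * of_real s ^ n) * indicator (ball (0::complex) s) w \<partial>lborel)" for n
      using int[of n] fin bound by (intro integral_mono integrable_mult_right integrable_norm) auto
    then show "summable (\<lambda>n. \<integral>w. norm (?f n w) \<partial>lborel)"
      by (intro summable_comparison_test'[OF summable_mult2[OF sm, of "measure lborel (ball (0::complex) s)"]]) (auto simp: mult.commute)
  qed (rule int)
  have "(\<integral>w. (\<Sum>n. ?f n w) \<partial>lborel) = (\<integral>w. indicator (ball 0 s) w *\<^sub>R f w \<partial>lborel)"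
  proof (rule Bochner_Integration.integral_cong)
    fix w :: complex
    show "(\<Sum>n. ?f n w) = indicator (ball 0 s) w *\<^sub>R f w"
      using sums[of w] s by (auto simp: indicator_def sums_iff)
  qed simp
  moreover have "integral\<^sup>L lborel (?f n) = (if n = 0 then measure lborel (ball (0::complex) s) *\<^sub>R f 0 else 0)" for n
  proof (cases "n = 0")
    case True
    then show ?thesis
      using fin by (simp add: a_def)
  next
    case False
    have "integral\<^sup>L lborel (?f n) = (\<integral>w. a n * (indicator (ball 0 s) w *\<^sub>R w ^ n) \<partial>lborel)"
      by (intro Bochner_Integration.integral_cong) auto
    also have "\<dots> = a n * (\<integral>w. indicator (ball 0 s) w *\<^sub>R w ^ n \<partial>lborel)"
      by (rule integral_mult_right_zero)
    finally show ?thesis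
      using False integral_ball_power_eq_0[of n s] by simp
  qed
  ultimately have "(\<lambda>n. if n = 0 then measure lborel (ball (0::complex) s) *\<^sub>R f 0 else 0) sums
      (\<integral>w. indicator (ball 0 s) w *\<^sub>R f w \<partial>lborel)"
    using sums' by simp
  then show ?thesis
    using sums_unique2 sums_single[of 0 "\<lambda>_. measure lborel (ball (0::complex) s) *\<^sub>R f 0"] by blast
qed

lemma holomorphic_area_mean_value:
  assumes f: "f holomorphic_on ball z r" and s: "0 < s" "s < r"
  shows "(\<integral>w. indicator (ball z s) w *\<^sub>R f w \<partial>lborel) = measure lborel (ball (0::complex) s) *\<^sub>R f z"
proof -
  have "(\<lambda>w. f (z + w)) holomorphic_on ball 0 r"
    using f by (intro holomorphic_on_compose_gen[unfolded o_def, of "\<lambda>w. z + w" _ f "ball z r"])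
      (auto intro!: holomorphic_intros simp: dist_norm)
  note mv = holomorphic_area_mean_value_0[OF this s]
  have "(\<integral>w. indicator (ball z s) w *\<^sub>R f w \<partial>lborel)
     = (\<integral>w. indicator (ball z s) (z + w) *\<^sub>R f (z + w) \<partial>lborel)"
    using holomorphic_on_imp_continuous_on[OF f] s
    by (subst lborel_distr_plus[of z, symmetric], subst integral_distr)
      (auto intro!: borel_measurable_continuous_on_indicator continuous_on_subset[OF holomorphic_on_imp_continuous_on[OF f]])
  also have "\<dots> = (\<integral>w. indicator (ball 0 s) w *\<^sub>R f (z + w) \<partial>lborel)"
    by (intro Bochner_Integration.integral_cong) (auto simp: indicator_def dist_norm)
  finally show ?thesis
    using mv by simp
qed

section \<open>Point evaluations and completeness of the Bergman space\<close>

lemma A2_L2: "f \<in> A2 \<Longrightarrow> f \<in> L2"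
  and A2_holomorphic: "f \<in> A2 \<Longrightarrow> f holomorphic_on disc"
  by (auto simp: A2_def)

lemma A2_lincomb:
  assumes "f \<in> A2" "g \<in> A2" shows "(\<lambda>z. c * f z + g z) \<in> A2"
  using assms L2_lincomb by (auto simp: A2_def intro!: holomorphic_intros)

lemma A2_diff: "f \<in> A2 \<Longrightarrow> g \<in> A2 \<Longrightarrow> (\<lambda>z. f z - g z) \<in> A2"
  using A2_lincomb[of g f "-1"] by simp

lemma A2_zero: "(\<lambda>z. 0) \<in> A2"
  by (simp add: A2_def L2_zero)

lemma A2_scale: "f \<in> A2 \<Longrightarrow> (\<lambda>z. c * f z) \<in> A2"
  using A2_lincomb[of f "\<lambda>z. 0" c] A2_zero by simp

lemma L2_bounded:
  assumes "f \<in> borel_measurable disc_measure" "\<And>z. z \<in> disc \<Longrightarrow> cmod (f z) \<le> B"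
  shows "f \<in> L2"
proof -
  have "integrable disc_measure (\<lambda>z. (cmod (f z))\<^sup>2)"
    by (rule finite_measure.integrable_const_bound[OF finite_disc_measure, where B = "B\<^sup>2"])
      (use assms in \<open>auto intro!: AE_I2 power_mono\<close>)
  then show ?thesis
    using assms(1) by (simp add: L2_iff)
qed

text \<open>By the area mean value property, \<open>f z\<close> is a multiple of the inner product
  of \<open>f\<close> with the indicator of a ball around \<open>z\<close>, and Cauchy-Schwarz
  bounds it. The norm of the indicator is estimated by that of the constant 1, so the constant does
  not depend on \<open>z\<close>.\<close>

lemma A2_eval_bound:
  assumes "\<rho> < 1"
  obtains C where "\<And>f z. f \<in> A2 \<Longrightarrow> z \<in> cball 0 \<rho> \<Longrightarrow> cmod (f z) \<le> C * l2_norm f"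
proof -
  \<comment> \<open>Half the gap to the unit circle, so that the balls of radius \<open>s\<close>
    around all points of \<open>cball 0 \<rho>\<close> stay inside the disc with room to
    spare.\<close>
  define s where "s = (1 - \<rho>) / 2"
  have s: "s > 0" "\<rho> + s < 1"
    using assms by (auto simp: s_def field_simps)
  define m where "m = measure lborel (ball (0::complex) s)"
  have m: "m > 0"
    using s content_ball_pos[of s "0::complex"] by (simp add: m_def)
  have "cmod (f z) \<le> pi / m * l2_norm (\<lambda>_. 1) * l2_norm f" if f: "f \<in> A2" and z: "z \<in> cball 0 \<rho>" for f z
  proof -
    define g :: "complex \<Rightarrow> complex" where "g w = (if w \<in> ball z s then 1 else 0)" for w
    have sub: "ball z (1 - cmod z) \<subseteq> disc"
    proof
      fix w assume "w \<in> ball z (1 - cmod z)"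
      then show "w \<in> disc"
        using norm_triangle_ineq2[of w z] by (simp add: disc_def dist_norm norm_minus_commute)
    qed
    have g: "g \<in> L2"
      unfolding g_def[abs_def] by (rule L2_bounded[where B = 1]) (auto intro!: measurable_restrict_space1)
    have "l2_inner f g = complex_of_real (1 / pi) * (\<integral>w. indicator disc w *\<^sub>R (f w * cnj (g w)) \<partial>lborel)"
      by (simp add: l2_inner_eq integral_restrict_space)
    also have "(\<integral>w. indicator disc w *\<^sub>R (f w * cnj (g w)) \<partial>lborel) = (\<integral>w. indicator (ball z s) w *\<^sub>R f w \<partial>lborel)"
      by (intro Bochner_Integration.integral_cong)
        (use sub s z in \<open>auto simp: g_def indicator_def subset_iff\<close>)
    also have "\<dots> = m *\<^sub>R f z"
      unfolding m_def
      by (rule holomorphic_area_mean_value[where r = "1 - cmod z"])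
        (use holomorphic_on_subset[OF A2_holomorphic[OF f] sub] s z in auto)
    finally have "m * cmod (f z) = pi * cmod (l2_inner f g)"
      using m by (simp add: norm_mult norm_divide)
    also have "\<dots> \<le> pi * (l2_norm f * l2_norm g)"
      using l2_cauchy_schwarz[OF A2_L2[OF f] g] by simp
    also have "l2_norm g \<le> l2_norm (\<lambda>_. 1)"
      unfolding l2_norm_eq
    proof (intro real_sqrt_le_mono mult_left_mono integral_mono)
      show "integrable disc_measure (\<lambda>z. (cmod (g z))\<^sup>2)"
        using g by (simp add: L2_iff)
      show "integrable disc_measure (\<lambda>z. (cmod 1)\<^sup>2)"
        using finite_measure.integrable_const[OF finite_disc_measure] by simp
    qed (auto simp: g_def indicator_def)
    finally have "m * cmod (f z) \<le> pi * (l2_norm f * l2_norm (\<lambda>_. 1))"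
      by (simp add: mult_left_mono)
    then show ?thesis
      using m by (simp add: field_simps)
  qed
  then show ?thesis
    using that by blast
qed

lemma A2_norm_0:
  assumes "f \<in> A2" "l2_norm f = 0" "z \<in> disc" shows "f z = 0"
proof -
  obtain C where "\<And>f w. f \<in> A2 \<Longrightarrow> w \<in> cball 0 (cmod z) \<Longrightarrow> cmod (f w) \<le> C * l2_norm f"
    using A2_eval_bound[of "cmod z"] assms(3) by (auto simp: disc_def)
  from this[OF assms(1), of z] assms(2) show ?thesis
    by simp
qed

text \<open>Fatou's lemma applied to the squared moduli.\<close>

lemma L2_pointwise_limit:
  assumes u: "\<And>m. u m \<in> L2" and lim: "\<And>z. z \<in> disc \<Longrightarrow> (\<lambda>m. u m z) \<longlonglongrightarrow> v z"
    and bound: "\<And>m. m \<ge> N \<Longrightarrow> l2_norm (u m) \<le> e"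
  shows "v \<in> L2" "l2_norm v \<le> e"
proof -
  have e: "e \<ge> 0"
    using bound[of N] l2_norm_nonneg[of "u N"] by linarith
  have um: "u m \<in> borel_measurable disc_measure" for m
    using u by (simp add: L2_iff)
  have vm: "v \<in> borel_measurable disc_measure"
    by (rule borel_measurable_LIMSEQ_metric[OF um]) (use lim in auto)
  have nn: "(\<integral>\<^sup>+z. ennreal ((cmod (u m z))\<^sup>2) \<partial>disc_measure) \<le> ennreal (pi * e\<^sup>2)" if "m \<ge> N" for m
  proof -
    have "(\<integral>\<^sup>+z. ennreal ((cmod (u m z))\<^sup>2) \<partial>disc_measure) = ennreal (\<integral>z. (cmod (u m z))\<^sup>2 \<partial>disc_measure)"
      using u by (intro nn_integral_eq_integral) (auto simp: L2_iff)
    also have "(\<integral>z. (cmod (u m z))\<^sup>2 \<partial>disc_measure) = pi * (l2_norm (u m))\<^sup>2"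
      by (simp add: l2_norm_eq)
    also have "\<dots> \<le> pi * e\<^sup>2"
      using bound[OF that] by (simp add: power_mono)
    finally show ?thesis
      by (simp add: ennreal_leI)
  qed
  have "(\<integral>\<^sup>+z. ennreal ((cmod (v z))\<^sup>2) \<partial>disc_measure)
      = (\<integral>\<^sup>+z. liminf (\<lambda>m. ennreal ((cmod (u m z))\<^sup>2)) \<partial>disc_measure)"
  proof (rule nn_integral_cong)
    fix z assume "z \<in> space disc_measure"
    then have "(\<lambda>m. ennreal ((cmod (u m z))\<^sup>2)) \<longlonglongrightarrow> ennreal ((cmod (v z))\<^sup>2)"
      by (intro tendsto_ennrealI tendsto_intros lim) simp
    then show "ennreal ((cmod (v z))\<^sup>2) = liminf (\<lambda>m. ennreal ((cmod (u m z))\<^sup>2))"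
      by (metis lim_imp_Liminf trivial_limit_sequentially)
  qed
  also have "\<dots> \<le> liminf (\<lambda>m. \<integral>\<^sup>+z. ennreal ((cmod (u m z))\<^sup>2) \<partial>disc_measure)"
    by (rule nn_integral_liminf) (use um in measurable)
  also have "\<dots> \<le> liminf (\<lambda>m. ennreal (pi * e\<^sup>2))"
    by (rule Liminf_mono) (use nn in \<open>auto simp: eventually_sequentially\<close>)
  finally have le: "(\<integral>\<^sup>+z. ennreal ((cmod (v z))\<^sup>2) \<partial>disc_measure) \<le> ennreal (pi * e\<^sup>2)"
    by (simp add: Liminf_const)
  then have int: "integrable disc_measure (\<lambda>z. (cmod (v z))\<^sup>2)"
    using vm by (intro integrableI_bounded) (auto intro: le_less_trans)
  then show "v \<in> L2"
    using vm by (simp add: L2_iff)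
  have "ennreal (\<integral>z. (cmod (v z))\<^sup>2 \<partial>disc_measure) \<le> ennreal (pi * e\<^sup>2)"
    using le nn_integral_eq_integral[OF int] by simp
  then have "(\<integral>z. (cmod (v z))\<^sup>2 \<partial>disc_measure) \<le> pi * e\<^sup>2"
    by (simp add: ennreal_le_iff)
  then have "l2_norm v \<le> sqrt (1 / pi * (pi * e\<^sup>2))"
    unfolding l2_norm_eq by (intro real_sqrt_le_mono mult_left_mono) auto
  then show "l2_norm v \<le> e"
    using e by simp
qed

definition l2_Cauchy :: "(nat \<Rightarrow> complex \<Rightarrow> complex) \<Rightarrow> bool" where
  "l2_Cauchy f \<longleftrightarrow> (\<forall>e>0. \<exists>N. \<forall>m\<ge>N. \<forall>n\<ge>N. l2_norm (\<lambda>z. f m z - f n z) < e)"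

text \<open>This plays the role of closedness in the projection theorem. It is applied both to the
  Bergman space and to ranges of Toeplitz operators.\<close>

definition l2_complete :: "(complex \<Rightarrow> complex) set \<Rightarrow> bool" where
  "l2_complete V \<longleftrightarrow> (\<forall>f. (\<forall>n. f n \<in> V) \<and> l2_Cauchy f \<longrightarrow>
     (\<exists>h\<in>V. (\<lambda>n. l2_norm (\<lambda>z. f n z - h z)) \<longlonglongrightarrow> 0))"

text \<open>Bounded point evaluations turn a Cauchy sequence in norm into one that converges
  uniformly on smaller closed discs, so the limit is holomorphic. Fatou's lemma for
  \<open>f n - f m\<close>, with \<open>m\<close> tending to infinity, then gives convergence in
  norm.\<close>

lemma A2_complete: "l2_complete A2"
  unfolding l2_complete_def
proof (intro allI impI, elim conjE)
  fix f :: "nat \<Rightarrow> complex \<Rightarrow> complex"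
  assume f: "\<forall>n. f n \<in> A2" and C: "l2_Cauchy f"
  \<comment> \<open>Convergence is established inside the disc only; the values of \<open>h\<close>
    elsewhere are irrelevant to its norm.\<close>
  define h where "h z = lim (\<lambda>n. f n z)" for z
  have ul: "uniform_limit (cball 0 \<rho>) f h sequentially" if \<rho>: "\<rho> < 1" for \<rho>
  proof -
    obtain K where K: "\<And>f z. f \<in> A2 \<Longrightarrow> z \<in> cball 0 \<rho> \<Longrightarrow> cmod (f z) \<le> K * l2_norm f"
      using A2_eval_bound[OF \<rho>] by metis
    have "uniformly_Cauchy_on (cball 0 \<rho>) f"
    proof (rule uniformly_Cauchy_onI)
      fix e :: real assume "e > 0"
      \<comment> \<open>The sign of \<open>K\<close> is unknown; \<open>\<bar>K\<bar> + 1\<close> is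
        a positive bound by which one can divide.\<close>
      then obtain N where N: "\<And>m n. m \<ge> N \<Longrightarrow> n \<ge> N \<Longrightarrow> l2_norm (\<lambda>z. f m z - f n z) < e / (\<bar>K\<bar> + 1)"
        using C unfolding l2_Cauchy_def by (metis abs_ge_zero divide_pos_pos add_nonneg_pos zero_less_one)
      have "dist (f m z) (f n z) < e" if "z \<in> cball 0 \<rho>" "m \<ge> N" "n \<ge> N" for z m n
      proof -
        have "dist (f m z) (f n z) \<le> K * l2_norm (\<lambda>z. f m z - f n z)"
          using K[OF A2_diff that(1), of "f m" "f n"] f by (simp add: dist_norm)
        also have "\<dots> \<le> (\<bar>K\<bar> + 1) * l2_norm (\<lambda>z. f m z - f n z)"
          by (rule mult_right_mono) auto
        also have "\<dots> < e"
          using N[OF that(2,3)] by (simp add: pos_less_divide_eq mult.commute add_nonneg_pos)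
        finally show ?thesis .
      qed
      then show "\<exists>M. \<forall>x\<in>cball 0 \<rho>. \<forall>m\<ge>M. \<forall>n\<ge>M. dist (f m x) (f n x) < e"
        by blast
    qed
    then have "uniformly_convergent_on (cball 0 \<rho>) f"
      by (rule Cauchy_uniformly_convergent)
    then show ?thesis
      by (simp add: uniformly_convergent_uniform_limit_iff h_def[abs_def])
  qed
  have hol: "h holomorphic_on disc"
  proof (rule holomorphic_uniform_sequence[OF open_disc])
    show "f n holomorphic_on disc" for n
      using f A2_holomorphic by blast
    fix x assume x: "x \<in> disc"
    define d where "d = (1 - cmod x) / 2"
    have d: "d > 0" "cmod x + d < 1"
      using x by (auto simp: d_def disc_def field_simps)
    have "cball x d \<subseteq> cball 0 (cmod x + d)"
      by (auto simp: dist_norm) (metis add.commute add_left_mono diff_add_cancel norm_minus_commute norm_triangle_ineq order_trans)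
    moreover from this have "cball x d \<subseteq> disc"
      using d by (auto simp: disc_def)
    ultimately show "\<exists>d>0. cball x d \<subseteq> disc \<and> uniform_limit (cball x d) f h sequentially"
      using d uniform_limit_on_subset[OF ul] by blast
  qed
  have pt: "(\<lambda>n. f n z) \<longlonglongrightarrow> h z" if "z \<in> disc" for z
    using tendsto_uniform_limitI[OF ul[of "cmod z"], of z] that by (simp add: disc_def)
  have key: "\<exists>N. \<forall>n\<ge>N. (\<lambda>z. f n z - h z) \<in> L2 \<and> l2_norm (\<lambda>z. f n z - h z) \<le> e" if "e > 0" for e
  proof -
    obtain N where N: "\<And>m n. m \<ge> N \<Longrightarrow> n \<ge> N \<Longrightarrow> l2_norm (\<lambda>z. f m z - f n z) < e"
      using C \<open>e > 0\<close> unfolding l2_Cauchy_def by metis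
    have "(\<lambda>z. f n z - h z) \<in> L2 \<and> l2_norm (\<lambda>z. f n z - h z) \<le> e" if "n \<ge> N" for n
    proof -
      have "(\<lambda>z. f n z - f m z) \<in> L2" for m
        using f by (intro L2_diff A2_L2) auto
      moreover have "(\<lambda>m. f n z - f m z) \<longlonglongrightarrow> f n z - h z" if "z \<in> disc" for z
        by (intro tendsto_intros pt that)
      ultimately show ?thesis
        using L2_pointwise_limit[of "\<lambda>m z. f n z - f m z" "\<lambda>z. f n z - h z" N e] N[OF that] less_imp_le by blast
    qed
    then show ?thesis by blast
  qed
  obtain N where "(\<lambda>z. f N z - h z) \<in> L2"
    using key[of 1] by auto
  then have "(\<lambda>z. f N z - (f N z - h z)) \<in> L2"
    using f A2_L2 L2_diff by blast
  then have "h \<in> A2"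
    using hol by (simp add: A2_def)
  moreover have "(\<lambda>n. l2_norm (\<lambda>z. f n z - h z)) \<longlonglongrightarrow> 0"
  proof (rule LIMSEQ_I)
    fix e :: real assume "e > 0"
    then obtain N where "\<And>n. n \<ge> N \<Longrightarrow> l2_norm (\<lambda>z. f n z - h z) \<le> e / 2"
      using key[of "e / 2"] by auto
    then show "\<exists>no. \<forall>n\<ge>no. norm (l2_norm (\<lambda>z. f n z - h z) - 0) < e"
      using \<open>e > 0\<close> by (intro exI[of _ N]) fastforce
  qed
  ultimately show "\<exists>h\<in>A2. (\<lambda>n. l2_norm (\<lambda>z. f n z - h z)) \<longlonglongrightarrow> 0"
    by blast
qed

section \<open>Orthogonal projections and Toeplitz operators\<close>

text \<open>The classical argument: a minimizing sequence for the distance from \<open>g\<close> to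
  \<open>V\<close> is Cauchy by the parallelogram law, and its limit attains the distance.
  Perturbing the minimizer along \<open>k\<close> shows orthogonality.\<close>

lemma projection_exists:
  assumes V: "V \<subseteq> L2" and ne: "V \<noteq> {}"
    and lin: "\<And>f g c. f \<in> V \<Longrightarrow> g \<in> V \<Longrightarrow> (\<lambda>z. c * f z + g z) \<in> V"
    and complete: "l2_complete V" and g: "g \<in> L2"
  obtains h where "h \<in> V" "\<And>k. k \<in> V \<Longrightarrow> l2_inner (\<lambda>z. g z - h z) k = 0"
proof -
  define d where "d = (INF v\<in>V. l2_norm (\<lambda>z. g z - v z))"
  have bdd: "bdd_below ((\<lambda>v. l2_norm (\<lambda>z. g z - v z)) ` V)"
    by (rule bdd_belowI[of _ 0]) auto
  have d_le: "d \<le> l2_norm (\<lambda>z. g z - v z)" if "v \<in> V" for v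
    unfolding d_def by (rule cINF_lower[OF bdd that])
  have d0: "d \<ge> 0"
    unfolding d_def using ne by (intro cINF_greatest) auto
  have "\<exists>v\<in>V. l2_norm (\<lambda>z. g z - v z) < d + e" if "e > 0" for e
    using cInf_lessD[of "(\<lambda>v. l2_norm (\<lambda>z. g z - v z)) ` V" "d + e"] ne that by (auto simp: d_def)
  then have "\<forall>n. \<exists>v\<in>V. l2_norm (\<lambda>z. g z - v z) < d + 1 / real (Suc n)"
    by simp
  then obtain f where f: "\<And>n. f n \<in> V" and fd: "\<And>n. l2_norm (\<lambda>z. g z - f n z) < d + 1 / real (Suc n)"
    by metis
  have fL: "f n \<in> L2" for n
    using f V by blast
  \<comment> \<open>the parallelogram law, the midpoint of \<open>f m\<close> and \<open>f n\<close> being at distance at least \<open>d\<close> from \<open>g\<close>\<close>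
  have para: "(l2_norm (\<lambda>z. f m z - f n z))\<^sup>2 \<le> 2 * (l2_norm (\<lambda>z. g z - f m z))\<^sup>2 + 2 * (l2_norm (\<lambda>z. g z - f n z))\<^sup>2 - 4 * d\<^sup>2" for m n
  proof -
    let ?x = "\<lambda>z. g z - f m z" and ?y = "\<lambda>z. g z - f n z"
    have xy: "?x \<in> L2" "?y \<in> L2"
      using g fL by (auto intro: L2_diff)
    \<comment> \<open>The midpoint of \<open>f m\<close> and \<open>f n\<close>, spelled as two
      nested combinations of the shape that \<open>lin\<close> accepts.\<close>
    have "(\<lambda>z. 1/2 * f m z + (-1/2 * f n z + f n z)) \<in> V"
      by (intro lin f)
    then have "d \<le> l2_norm (\<lambda>z. g z - (1/2 * f m z + (-1/2 * f n z + f n z)))"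
      by (rule d_le)
    also have "(\<lambda>z. g z - (1/2 * f m z + (-1/2 * f n z + f n z))) = (\<lambda>z. 1/2 * (1 * ?x z + ?y z))"
      by (simp add: fun_eq_iff field_simps)
    also have "l2_norm \<dots> = 1/2 * l2_norm (\<lambda>z. 1 * ?x z + ?y z)"
      by (subst l2_norm_scale) simp
    finally have "(2 * d)\<^sup>2 \<le> (l2_norm (\<lambda>z. 1 * ?x z + ?y z))\<^sup>2"
      using d0 by (intro power_mono) auto
    moreover have "(l2_norm (\<lambda>z. 1 * ?x z + ?y z))\<^sup>2 + (l2_norm (\<lambda>z. (-1) * ?x z + ?y z))\<^sup>2
        = 2 * (l2_norm ?x)\<^sup>2 + 2 * (l2_norm ?y)\<^sup>2"
      unfolding l2_norm_lincomb_sq[OF xy] by simp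
    moreover have "(\<lambda>z. (-1) * ?x z + ?y z) = (\<lambda>z. f m z - f n z)"
      by (simp add: fun_eq_iff)
    ultimately show ?thesis
      by (simp add: power_mult_distrib)
  qed
  have "l2_Cauchy f"
    unfolding l2_Cauchy_def
  proof (intro allI impI)
    fix e :: real assume e: "e > 0"
    \<comment> \<open>This is the right side of \<open>para\<close> with both squared distances
      replaced by their bound for the minimizing sequence.\<close>
    have "(\<lambda>n. 4 * (d + 1 / real (Suc n))\<^sup>2 - 4 * d\<^sup>2) \<longlonglongrightarrow> 4 * (d + 0)\<^sup>2 - 4 * d\<^sup>2"
      by (intro tendsto_intros LIMSEQ_Suc[OF lim_1_over_n])
    then have "\<forall>\<^sub>F n in sequentially. 4 * (d + 1 / real (Suc n))\<^sup>2 - 4 * d\<^sup>2 < e\<^sup>2"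
      using e by (intro order_tendstoD) auto
    then obtain N where N: "4 * (d + 1 / real (Suc N))\<^sup>2 - 4 * d\<^sup>2 < e\<^sup>2"
      by (auto simp: eventually_sequentially)
    have b: "(l2_norm (\<lambda>z. g z - f n z))\<^sup>2 \<le> (d + 1 / real (Suc N))\<^sup>2" if "n \<ge> N" for n
    proof (rule power_mono)
      have "1 / real (Suc n) \<le> 1 / real (Suc N)"
        using that by (intro divide_left_mono) auto
      then show "l2_norm (\<lambda>z. g z - f n z) \<le> d + 1 / real (Suc N)"
        using fd[of n] by linarith
    qed simp
    have "l2_norm (\<lambda>z. f m z - f n z) < e" if "m \<ge> N" "n \<ge> N" for m n
    proof (rule power2_less_imp_less)
      show "(l2_norm (\<lambda>z. f m z - f n z))\<^sup>2 < e\<^sup>2"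
        using para[of m n] b[OF that(1)] b[OF that(2)] N by linarith
    qed (use e in simp)
    then show "\<exists>N. \<forall>m\<ge>N. \<forall>n\<ge>N. l2_norm (\<lambda>z. f m z - f n z) < e"
      by blast
  qed
  then obtain h where h: "h \<in> V" and lim: "(\<lambda>n. l2_norm (\<lambda>z. f n z - h z)) \<longlonglongrightarrow> 0"
    using complete f unfolding l2_complete_def by blast
  have hL: "h \<in> L2"
    using h V by blast
  have u: "(\<lambda>z. g z - h z) \<in> L2"
    using g hL by (rule L2_diff)
  have "l2_norm (\<lambda>z. g z - h z) \<le> d"
  proof (rule LIMSEQ_le_const)
    show "(\<lambda>n. (d + 1 / real (Suc n)) + l2_norm (\<lambda>z. f n z - h z)) \<longlonglongrightarrow> d"
      using tendsto_add[OF tendsto_add[OF tendsto_const LIMSEQ_Suc[OF lim_1_over_n]] lim, of d] by simp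
    show "\<exists>N. \<forall>n\<ge>N. l2_norm (\<lambda>z. g z - h z) \<le> (d + 1 / real (Suc n)) + l2_norm (\<lambda>z. f n z - h z)"
    proof (intro exI allI impI)
      fix n
      show "l2_norm (\<lambda>z. g z - h z) \<le> (d + 1 / real (Suc n)) + l2_norm (\<lambda>z. f n z - h z)"
        using l2_norm_triangle_diff[OF g fL hL, of n] fd[of n] by linarith
    qed
  qed
  with d_le[OF h] have hd: "l2_norm (\<lambda>z. g z - h z) = d"
    by simp
  have "l2_inner (\<lambda>z. g z - h z) k = 0" if k: "k \<in> V" for k
  proof -
    have kL: "k \<in> L2"
      using k V by blast
    define a where "a = l2_inner k (\<lambda>z. g z - h z)"
    \<comment> \<open>With this step size the quadratic term is at most
      \<open>t * (cmod a)\<^sup>2\<close>, while the linear term is minus twice that amount, so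
      minimality forces \<open>a = 0\<close>. The added 1 avoids a division by zero.\<close>
    define t where "t = 1 / ((l2_norm k)\<^sup>2 + 1)"
    have t: "t > 0" "t * (l2_norm k)\<^sup>2 \<le> 1"
      using zero_le_power2[of "l2_norm k"] by (auto simp: t_def add_nonneg_pos divide_le_eq_1)
    define c where "c = - complex_of_real t * cnj a"
    have "(\<lambda>z. - c * k z + h z) \<in> V"
      using k h by (rule lin)
    then have "d \<le> l2_norm (\<lambda>z. g z - (- c * k z + h z))"
      by (rule d_le)
    also have "(\<lambda>z. g z - (- c * k z + h z)) = (\<lambda>z. c * k z + (g z - h z))"
      by (simp add: fun_eq_iff)
    finally have "d\<^sup>2 \<le> (l2_norm (\<lambda>z. c * k z + (g z - h z)))\<^sup>2"
      using d0 by (intro power_mono)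
    then have "0 \<le> (cmod c)\<^sup>2 * (l2_norm k)\<^sup>2 + 2 * Re (c * a)"
      unfolding l2_norm_lincomb_sq[OF kL u] hd a_def by simp
    also have "c * a = - complex_of_real (t * (cmod a)\<^sup>2)"
      unfolding c_def by (simp only: of_real_mult complex_norm_square) (simp add: algebra_simps)
    also have "(cmod c)\<^sup>2 * (l2_norm k)\<^sup>2 = t * (cmod a)\<^sup>2 * (t * (l2_norm k)\<^sup>2)"
      by (simp add: c_def norm_mult power2_eq_square)
    also have "\<dots> \<le> t * (cmod a)\<^sup>2 * 1"
      using t by (intro mult_left_mono) auto
    finally have "t * (cmod a)\<^sup>2 \<le> 0"
      by simp
    then have "a = 0"
      using t by (simp add: mult_le_0_iff)
    then show ?thesis
      using l2_inner_commute[of "\<lambda>z. g z - h z" k] by (simp add: a_def)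
  qed
  with h that show ?thesis by blast
qed

text \<open>Existence of a projection makes the choice in the definition of
  \<open>bergman_proj\<close> meaningful. From here on it is used only through its inner products
  with members of \<open>A2\<close>.\<close>

lemma bergman_proj:
  assumes "g \<in> L2"
  shows "bergman_proj g \<in> A2" "\<And>k. k \<in> A2 \<Longrightarrow> l2_inner (bergman_proj g) k = l2_inner g k"
proof -
  obtain h where "h \<in> A2" "\<And>k. k \<in> A2 \<Longrightarrow> l2_inner (\<lambda>z. g z - h z) k = 0"
    using projection_exists[of A2 g] A2_L2 A2_zero A2_lincomb A2_complete assms by blast
  then have *: "bergman_proj g \<in> A2 \<and> (\<forall>k\<in>A2. l2_inner (\<lambda>z. g z - bergman_proj g z) k = 0)"
    unfolding bergman_proj_def
    by (intro someI[of "\<lambda>h. h \<in> A2 \<and> (\<forall>k\<in>A2. l2_inner (\<lambda>z. g z - h z) k = 0)" h]) blast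
  then show "bergman_proj g \<in> A2"
    by simp
  fix k assume "k \<in> A2"
  with * show "l2_inner (bergman_proj g) k = l2_inner g k"
    using l2_inner_diff_left[OF assms A2_L2 A2_L2, of "bergman_proj g" k] by simp
qed

text \<open>The difference is orthogonal to itself. Since a projection is determined only on the
  disc, identities between Toeplitz operators are proved there by testing against
  \<open>A2\<close>.\<close>

lemma A2_eqI:
  assumes "f \<in> A2" "g \<in> A2" "\<And>k. k \<in> A2 \<Longrightarrow> l2_inner f k = l2_inner g k" "z \<in> disc"
  shows "f z = g z"
proof -
  have d: "(\<lambda>z. f z - g z) \<in> A2"
    using assms A2_diff by blast
  have "l2_inner (\<lambda>z. f z - g z) (\<lambda>z. f z - g z) = 0"
    using l2_inner_diff_left[OF A2_L2 A2_L2 A2_L2, OF assms(1,2) d] assms(3)[OF d] by simp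
  then have "l2_norm (\<lambda>z. f z - g z) = 0"
    by (simp add: l2_inner_self)
  from A2_norm_0[OF d this assms(4)] show ?thesis
    by simp
qed

text \<open>The regularity retained from continuity on the closed disc. It is stable under
  conjugation, so each result also applies to the adjoint operator.\<close>

definition disc_symbol :: "(complex \<Rightarrow> complex) \<Rightarrow> bool" where
  "disc_symbol \<phi> \<longleftrightarrow> continuous_on disc \<phi> \<and> (\<exists>B. \<forall>z\<in>disc. cmod (\<phi> z) \<le> B)"

lemma disc_symbol_cnj: "disc_symbol \<phi> \<Longrightarrow> disc_symbol (\<lambda>z. cnj (\<phi> z))"
  by (auto simp: disc_symbol_def intro!: continuous_intros)

lemma disc_symbol_mult_L2:
  assumes "disc_symbol \<phi>" "f \<in> L2" shows "(\<lambda>z. \<phi> z * f z) \<in> L2"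
  using assms L2_mult_bounded[OF assms(2) continuous_measurable_disc, of \<phi>] by (auto simp: disc_symbol_def)

lemma toeplitz_A2: "disc_symbol \<phi> \<Longrightarrow> f \<in> A2 \<Longrightarrow> toeplitz \<phi> f \<in> A2"
  unfolding toeplitz_def by (intro bergman_proj disc_symbol_mult_L2 A2_L2)

lemma l2_inner_toeplitz:
  "disc_symbol \<phi> \<Longrightarrow> f \<in> A2 \<Longrightarrow> k \<in> A2 \<Longrightarrow> l2_inner (toeplitz \<phi> f) k = l2_inner (\<lambda>z. \<phi> z * f z) k"
  unfolding toeplitz_def by (intro bergman_proj disc_symbol_mult_L2 A2_L2)

lemma l2_inner_toeplitz_adjoint:
  assumes "disc_symbol \<phi>" "f \<in> A2" "g \<in> A2"
  shows "l2_inner (toeplitz \<phi> f) g = l2_inner f (toeplitz (\<lambda>z. cnj (\<phi> z)) g)"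
proof -
  have "l2_inner f (toeplitz (\<lambda>z. cnj (\<phi> z)) g) = cnj (l2_inner (\<lambda>z. cnj (\<phi> z) * g z) f)"
    using assms by (subst l2_inner_commute) (simp add: l2_inner_toeplitz disc_symbol_cnj)
  also have "\<dots> = l2_inner (\<lambda>z. \<phi> z * f z) g"
    by (subst l2_inner_commute[symmetric]) (simp add: l2_inner_eq mult.assoc mult.left_commute)
  finally show ?thesis
    using assms by (simp add: l2_inner_toeplitz)
qed

lemma toeplitz_lincomb:
  assumes "disc_symbol \<phi>" "f \<in> A2" "g \<in> A2" "z \<in> disc"
  shows "toeplitz \<phi> (\<lambda>w. c * f w + g w) z = c * toeplitz \<phi> f z + toeplitz \<phi> g z"
proof (rule A2_eqI[where g = "\<lambda>z. c * toeplitz \<phi> f z + toeplitz \<phi> g z"])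
  show "toeplitz \<phi> (\<lambda>w. c * f w + g w) \<in> A2" "(\<lambda>z. c * toeplitz \<phi> f z + toeplitz \<phi> g z) \<in> A2"
    using assms by (auto intro!: toeplitz_A2 A2_lincomb)
  fix k assume k: "k \<in> A2"
  have "l2_inner (toeplitz \<phi> (\<lambda>w. c * f w + g w)) k = l2_inner (\<lambda>z. c * (\<phi> z * f z) + \<phi> z * g z) k"
    using assms k by (subst l2_inner_toeplitz) (auto simp: A2_lincomb distrib_left mult.left_commute)
  also have "\<dots> = c * l2_inner (\<lambda>z. \<phi> z * f z) k + l2_inner (\<lambda>z. \<phi> z * g z) k"
    using assms k by (intro l2_inner_lincomb_left disc_symbol_mult_L2 A2_L2)
  also have "\<dots> = l2_inner (\<lambda>z. c * toeplitz \<phi> f z + toeplitz \<phi> g z) k"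
    using assms k by (simp add: l2_inner_toeplitz l2_inner_lincomb_left toeplitz_A2 A2_L2)
  finally show "l2_inner (toeplitz \<phi> (\<lambda>w. c * f w + g w)) k = l2_inner (\<lambda>z. c * toeplitz \<phi> f z + toeplitz \<phi> g z) k" .
qed (rule assms)

lemma toeplitz_diff:
  assumes "disc_symbol \<phi>" "f \<in> A2" "g \<in> A2" "z \<in> disc"
  shows "toeplitz \<phi> (\<lambda>w. f w - g w) z = toeplitz \<phi> f z - toeplitz \<phi> g z"
  using toeplitz_lincomb[of \<phi> g f z "-1"] assms by simp

text \<open>Testing \<open>toeplitz \<phi> f\<close> against itself replaces it by
  \<open>\<phi> f\<close> in one factor; Cauchy-Schwarz then allows one norm to be
  cancelled.\<close>

lemma toeplitz_bounded:
  assumes "disc_symbol \<phi>"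
  obtains B where "\<And>f. f \<in> A2 \<Longrightarrow> l2_norm (toeplitz \<phi> f) \<le> B * l2_norm f"
proof -
  obtain B where B: "\<And>z. z \<in> disc \<Longrightarrow> cmod (\<phi> z) \<le> B"
    using assms by (auto simp: disc_symbol_def)
  have B0: "B \<ge> 0"
    using B[OF zero_in_disc] norm_ge_zero order_trans by blast
  have "l2_norm (toeplitz \<phi> f) \<le> B * l2_norm f" if f: "f \<in> A2" for f
  proof -
    let ?T = "toeplitz \<phi> f"
    have L: "(\<lambda>z. \<phi> z * f z) \<in> L2" "(\<lambda>z. complex_of_real B * f z) \<in> L2"
      using assms f by (auto intro: disc_symbol_mult_L2 A2_L2 L2_scale)
    have T: "?T \<in> A2"
      using assms f by (rule toeplitz_A2)
    have "(l2_norm ?T)\<^sup>2 = cmod (l2_inner ?T ?T)"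
      by (simp add: l2_inner_self norm_power)
    also have "\<dots> = cmod (l2_inner (\<lambda>z. \<phi> z * f z) ?T)"
      using assms f T by (simp add: l2_inner_toeplitz)
    also have "\<dots> \<le> l2_norm (\<lambda>z. \<phi> z * f z) * l2_norm ?T"
      using l2_cauchy_schwarz[OF L(1) A2_L2[OF T]] .
    finally have "l2_norm ?T \<le> l2_norm (\<lambda>z. \<phi> z * f z)"
      by (cases "l2_norm ?T = 0") (auto simp: power2_eq_square mult_le_cancel_right order_less_le)
    also have "\<dots> \<le> l2_norm (\<lambda>z. complex_of_real B * f z)"
      unfolding l2_norm_eq
      by (intro real_sqrt_le_mono mult_left_mono integral_mono)
        (use L B B0 in \<open>auto simp: L2_iff norm_mult intro!: power_mono mult_right_mono\<close>)
    also have "\<dots> = B * l2_norm f"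
      using B0 by (simp add: l2_norm_scale)
    finally show ?thesis .
  qed
  then show ?thesis
    using that by blast
qed

section \<open>Accretive symbols\<close>

text \<open>The set where \<open>q\<close> does not vanish is open and null, hence empty.\<close>

lemma continuous_AE_zero_disc:
  fixes q :: "complex \<Rightarrow> real"
  assumes q: "continuous_on disc q" and ae: "AE z in disc_measure. q z = 0" and z: "z \<in> disc"
  shows "q z = 0"
proof (rule ccontr)
  assume nz: "q z \<noteq> 0"
  let ?U = "q -` (- {0}) \<inter> disc"
  have op: "open ?U"
    using continuous_open_preimage[OF q open_disc open_Compl[OF closed_singleton[of 0]]] by (simp add: Int_commute)
  have "AE z in lborel. z \<in> disc \<longrightarrow> q z = 0"
    using ae by (subst (asm) AE_restrict_space_iff) auto
  then have "AE z in lborel. z \<notin> ?U"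
    by eventually_elim auto
  then have "?U \<in> null_sets lborel"
    using op by (simp add: AE_iff_null_sets)
  then have "negligible ?U"
    by (simp add: negligible_iff_null_sets null_sets_completionI)
  then show False
    using open_not_negligible[OF op] nz z by auto
qed

text \<open>The continuous nonnegative function \<open>Re \<phi> * |f|^2\<close> has integral zero,
  so it vanishes everywhere. Where \<open>f\<close> is nonzero, \<open>Re \<phi> = 0\<close> forces
  \<open>Im \<phi> = 0\<close> through \<open>acc\<close>; thus \<open>f\<close> vanishes on the
  open set where \<open>\<phi>\<close> does not, which contains \<open>z0\<close>.\<close>

lemma accretive_kernel_trivial:
  assumes \<phi>: "disc_symbol \<phi>" and acc: "\<And>z. z \<in> disc \<Longrightarrow> Re (\<phi> z) \<ge> \<bar>Im (\<phi> z)\<bar>\<^sup>2"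
    and nz: "z0 \<in> disc" "\<phi> z0 \<noteq> 0" and f: "f \<in> A2" and 0: "l2_inner (\<lambda>z. \<phi> z * f z) f = 0"
    and z: "z \<in> disc"
  shows "f z = 0"
proof -
  have c\<phi>: "continuous_on disc \<phi>"
    using \<phi> by (simp add: disc_symbol_def)
  have cf: "continuous_on disc f"
    using f by (simp add: A2_holomorphic holomorphic_on_imp_continuous_on)
  let ?q = "\<lambda>z. Re (\<phi> z) * (cmod (f z))\<^sup>2"
  have int: "integrable disc_measure (\<lambda>z. \<phi> z * f z * cnj (f z))"
    using L2_integrable_inner[OF disc_symbol_mult_L2[OF \<phi>] , OF A2_L2 A2_L2, OF f f] .
  have q: "Re (\<phi> z * f z * cnj (f z)) = ?q z" for z
    by (simp add: mult.assoc complex_norm_square[symmetric])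
  have "(\<integral>z. \<phi> z * f z * cnj (f z) \<partial>disc_measure) = 0"
    using 0 by (simp add: l2_inner_eq)
  then have "(\<integral>z. ?q z \<partial>disc_measure) = 0"
    using integral_Re[OF int] by (simp only: q zero_complex.sel)
  moreover have "integrable disc_measure ?q"
    using integrable_Re[OF int] by (simp only: q)
  moreover have nn: "Re (\<phi> z) \<ge> 0" if "z \<in> disc" for z
    using acc[OF that] zero_le_power2[of "\<bar>Im (\<phi> z)\<bar>"] by linarith
  ultimately have "AE z in disc_measure. ?q z = 0"
    by (subst (asm) integral_nonneg_eq_0_iff_AE) (auto intro!: AE_I2)
  then have q0: "?q w = 0" if "w \<in> disc" for w
    using that by (intro continuous_AE_zero_disc[where q = ?q] continuous_intros c\<phi> cf) auto
  have \<phi>f: "f w = 0" if "w \<in> disc" "\<phi> w \<noteq> 0" for w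
  proof (rule ccontr)
    assume "f w \<noteq> 0"
    then have "Re (\<phi> w) = 0"
      using q0[OF that(1)] by simp
    with acc[OF that(1)] have "Im (\<phi> w) = 0"
      by simp
    with \<open>Re (\<phi> w) = 0\<close> that(2) show False
      by (simp add: complex_eq_iff)
  qed
  let ?U = "disc \<inter> \<phi> -` (- {0})"
  have U: "open ?U" "z0 \<in> ?U"
    using continuous_open_preimage[OF c\<phi> open_disc open_Compl[OF closed_singleton[of 0]]] nz by auto
  show ?thesis
    by (rule analytic_continuation_open[where g = "\<lambda>_. 0", OF U(1) open_disc _ connected_disc _ A2_holomorphic[OF f] _ _ z])
      (use U \<phi>f in auto)
qed

section \<open>Infinite dimension of the Bergman space\<close>

lemma sum_fun_apply: "(\<Sum>x\<in>A. F x) z = (\<Sum>x\<in>A. (F x z :: complex))"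
  by (induction A rule: infinite_finite_induct) auto

lemma power_A2: "(\<lambda>z. z ^ n) \<in> A2"
  by (auto simp: A2_def disc_def power_le_one norm_power intro!: L2_bounded[where B = 1]
      holomorphic_intros continuous_measurable_disc continuous_intros)

text \<open>The monomials are independent on the disc because a nonzero polynomial has finitely many
  roots, so more of them than \<open>card B\<close> cannot lie in the span of
  \<open>B\<close>.\<close>

lemma A2_infinite_dimensional:
  assumes B: "finite B" and span: "\<And>f. f \<in> A2 \<Longrightarrow> \<exists>c. \<forall>z\<in>disc. f z = (\<Sum>b\<in>B. c b * b z)"
  shows False
proof -
  interpret vs: vector_space "\<lambda>(c::complex) (f::complex \<Rightarrow> complex) z. c * f z"
    by unfold_locales (auto simp: fun_eq_iff algebra_simps)
  \<comment> \<open>Cutting functions off to zero outside the disc turns agreement on the disc into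
    equality, as the vector space of all functions requires.\<close>
  define r where "r f = (\<lambda>z. if z \<in> disc then f z else 0)" for f :: "complex \<Rightarrow> complex"
  define p where "p n = r (\<lambda>z. z ^ n)" for n
  define N where "N = card B"
  have inj: "inj p"
  proof (rule injI)
    fix m n assume "p m = p n"
    then have "p m (1/2) = p n (1/2)" by simp
    then have "(1/2 :: complex) ^ m = (1/2) ^ n"
      by (simp add: p_def r_def disc_def)
    then have "(1/2 :: real) ^ m = (1/2) ^ n"
      by (metis norm_power norm_divide norm_one norm_numeral)
    then show "m = n"
      by (simp add: power_inject_exp')
  qed
  \<comment> \<open>The index set \<open>{..N}\<close> has \<open>N + 1\<close> elements, one more
    than the spanning set can accommodate.\<close>
  have ind: "vs.independent (p ` {..N})"
  proof (rule vs.independent_if_scalars_zero)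
    fix c x assume sum0: "(\<Sum>x\<in>p ` {..N}. (\<lambda>z. c x * x z)) = 0" and x: "x \<in> p ` {..N}"
    have "(\<Sum>i\<le>N. c (p i) * z ^ i) = 0" if "z \<in> disc" for z
    proof -
      have "(\<Sum>x\<in>p ` {..N}. (\<lambda>z. c x * x z)) z = (\<Sum>i\<le>N. c (p i) * p i z)"
        by (subst sum.reindex) (auto simp: sum_fun_apply intro: inj_on_subset[OF inj])
      then show ?thesis
        using sum0 that by (simp add: p_def r_def)
    qed
    then have "disc \<subseteq> {z. (\<Sum>i\<le>N. c (p i) * z ^ i) = 0}"
      by auto
    moreover have "infinite disc"
      using finite_imp_not_open[of disc] open_disc zero_in_disc by auto
    ultimately have "infinite {z. (\<Sum>i\<le>N. c (p i) * z ^ i) = 0}"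
      using infinite_super by blast
    then show "c x = 0"
      using polyfun_finite_roots[of "\<lambda>i. c (p i)" N] x by auto
  qed simp
  have "p ` {..N} \<subseteq> vs.span (r ` B)"
  proof clarify
    fix n
    obtain c where c: "\<forall>z\<in>disc. z ^ n = (\<Sum>b\<in>B. c b * b z)"
      using span[OF power_A2] by blast
    have "p n = (\<Sum>b\<in>B. (\<lambda>z. c b * r b z))"
      using c by (auto simp: fun_eq_iff sum_fun_apply p_def r_def)
    also have "\<dots> \<in> vs.span (r ` B)"
      by (intro vs.span_sum vs.span_scale vs.span_base imageI)
    finally show "p n \<in> vs.span (r ` B)" .
  qed
  then have "card (p ` {..N}) \<le> card (r ` B)"
    using vs.independent_span_bound[OF _ ind] B by blast
  also have "\<dots> \<le> N"
    using card_image_le[OF B] by (simp add: N_def)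
  finally show False
    using card_image[OF inj_on_subset[OF inj subset_UNIV], of "{..N}"] by simp
qed

section \<open>Surjectivity from a complete range, and the uniform boundedness principle\<close>

definition toeplitz_range :: "(complex \<Rightarrow> complex) \<Rightarrow> (complex \<Rightarrow> complex) set" where
  "toeplitz_range \<phi> = {g \<in> A2. \<exists>f\<in>A2. \<forall>z\<in>disc. toeplitz \<phi> f z = g z}"

text \<open>Project \<open>g\<close> onto the range. The remainder \<open>u\<close> is orthogonal in
  particular to \<open>toeplitz \<phi> u\<close>, and accretivity makes it vanish.\<close>

lemma toeplitz_surj:
  assumes \<phi>: "disc_symbol \<phi>" and acc: "\<And>z. z \<in> disc \<Longrightarrow> Re (\<phi> z) \<ge> \<bar>Im (\<phi> z)\<bar>\<^sup>2"
    and nz: "z0 \<in> disc" "\<phi> z0 \<noteq> 0" and complete: "l2_complete (toeplitz_range \<phi>)"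
    and g: "g \<in> A2"
  shows "\<exists>f\<in>A2. \<forall>z\<in>disc. toeplitz \<phi> f z = g z"
proof -
  have sub: "toeplitz_range \<phi> \<subseteq> L2"
    by (auto simp: toeplitz_range_def A2_L2)
  have mem: "toeplitz \<phi> f \<in> toeplitz_range \<phi>" if "f \<in> A2" for f
    using that toeplitz_A2[OF \<phi>] by (auto simp: toeplitz_range_def)
  have lin: "(\<lambda>z. c * f z + g z) \<in> toeplitz_range \<phi>"
    if fg: "f \<in> toeplitz_range \<phi>" "g \<in> toeplitz_range \<phi>" for f g c
  proof -
    obtain a b where "f \<in> A2" "g \<in> A2" "a \<in> A2" "b \<in> A2" "\<forall>z\<in>disc. toeplitz \<phi> a z = f z" "\<forall>z\<in>disc. toeplitz \<phi> b z = g z"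
      using fg unfolding toeplitz_range_def by blast
    then show ?thesis
      unfolding toeplitz_range_def
      by (auto simp: A2_lincomb toeplitz_lincomb[OF \<phi>] intro!: bexI[of _ "\<lambda>z. c * a z + b z"])
  qed
  obtain h where h: "h \<in> toeplitz_range \<phi>" and orth: "\<And>k. k \<in> toeplitz_range \<phi> \<Longrightarrow> l2_inner (\<lambda>z. g z - h z) k = 0"
    using projection_exists[OF sub _ lin complete A2_L2[OF g]] mem[OF A2_zero] by blast
  define u where "u = (\<lambda>z. g z - h z)"
  have u: "u \<in> A2"
    using g h by (simp add: u_def toeplitz_range_def A2_diff)
  have "l2_inner u (toeplitz \<phi> u) = 0"
    using orth[OF mem[OF u]] by (simp add: u_def)
  then have "l2_inner (\<lambda>z. \<phi> z * u z) u = 0"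
    using l2_inner_commute[of "toeplitz \<phi> u" u] l2_inner_toeplitz[OF \<phi> u u] by simp
  then have "u z = 0" if "z \<in> disc" for z
    using accretive_kernel_trivial[OF \<phi> acc nz u] that by blast
  then have "\<forall>z\<in>disc. g z = h z"
    by (simp add: u_def)
  then show ?thesis
    using h by (auto simp: toeplitz_range_def)
qed

text \<open>A gliding hump argument in place of Baire category. If \<open>H\<close> were unbounded,
  choose \<open>h n\<close> of rapidly growing norm and build a Cauchy sequence whose step
  \<open>n\<close> has length at most \<open>(1/3) ^ n\<close> and leaves a large inner product with
  \<open>h n\<close>. The later steps are too short to undo this, so the limit has unbounded inner
  products with \<open>H\<close>.\<close>

lemma A2_uniform_boundedness:
  assumes H: "H \<subseteq> A2" and pt: "\<And>g. g \<in> A2 \<Longrightarrow> \<exists>K. \<forall>h\<in>H. cmod (l2_inner g h) \<le> K"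
  shows "\<exists>C. \<forall>h\<in>H. l2_norm h \<le> C"
proof (rule ccontr)
  assume "\<nexists>C. \<forall>h\<in>H. l2_norm h \<le> C"
  \<comment> \<open>The growth is chosen so that half of \<open>(1/3) ^ n * l2_norm (h n)\<close>,
    the part of the hump that survives at the end, still exceeds \<open>n\<close>.\<close>
  then have "\<forall>n. \<exists>h\<in>H. l2_norm h > 2 * real n * 3 ^ n"
    by (meson not_le)
  then obtain h where hH: "\<And>n. h n \<in> H" and hn: "\<And>n. l2_norm (h n) > 2 * real n * 3 ^ n"
    by metis
  have h: "h n \<in> A2" for n
    using hH H by blast
  have hpos: "l2_norm (h n) > 0" for n
    using hn[of n] by (rule order.strict_trans1[rotated]) simp
  have step: "\<exists>y\<in>A2. l2_norm (\<lambda>z. y z - x z) \<le> (1/3) ^ n \<and> cmod (l2_inner y (h n)) \<ge> (1/3) ^ n * l2_norm (h n)"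
    if x: "x \<in> A2" for x n
  proof -
    \<comment> \<open>Moving from \<open>x\<close> by \<open>t * h n\<close> or by its negative has
      length \<open>(1/3) ^ n\<close>. The two resulting inner products with \<open>h n\<close>
      differ by \<open>2 * (1/3) ^ n * l2_norm (h n)\<close>, so at least one is large
      enough.\<close>
    define t where "t = complex_of_real ((1/3) ^ n / l2_norm (h n))"
    let ?y = "\<lambda>s z. s * h n z + x z"
    have y: "?y s \<in> A2" for s
      using h x by (rule A2_lincomb)
    have d: "l2_norm (\<lambda>z. ?y s z - x z) = cmod s * l2_norm (h n)" for s
      by (simp add: l2_norm_scale)
    have ct: "cmod t = (1/3) ^ n / l2_norm (h n)"
      unfolding t_def norm_of_real using hpos[of n] by simp
    have i: "l2_inner (?y s) (h n) = s * l2_inner (h n) (h n) + l2_inner x (h n)" for s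
      using h x by (intro l2_inner_lincomb_left A2_L2)
    have "l2_inner (?y t) (h n) - l2_inner (?y (-t)) (h n) = 2 * (t * l2_inner (h n) (h n))"
      unfolding i by simp
    also have "t * l2_inner (h n) (h n) = complex_of_real ((1/3) ^ n * l2_norm (h n))"
      unfolding t_def l2_inner_self of_real_mult[symmetric] using hpos[of n] by (simp add: power2_eq_square)
    finally have "cmod (l2_inner (?y t) (h n) - l2_inner (?y (-t)) (h n)) = 2 * ((1/3) ^ n * l2_norm (h n))"
      using hpos[of n] by (simp add: norm_mult norm_power norm_divide)
    then consider "cmod (l2_inner (?y t) (h n)) \<ge> (1/3) ^ n * l2_norm (h n)"
      | "cmod (l2_inner (?y (-t)) (h n)) \<ge> (1/3) ^ n * l2_norm (h n)"
      using norm_triangle_ineq4[of "l2_inner (?y t) (h n)" "l2_inner (?y (-t)) (h n)"] by linarith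
    then show ?thesis
    proof cases
      case 1
      with d[of t] hpos[of n] show ?thesis
        by (intro bexI[OF _ y[of t]] conjI) (simp_all add: ct)
    next
      case 2
      with d[of "-t"] hpos[of n] show ?thesis
        by (intro bexI[OF _ y[of "-t"]] conjI) (simp_all add: ct)
    qed
  qed
  have "\<exists>x. \<forall>n. x n \<in> A2 \<and> (l2_norm (\<lambda>z. x (Suc n) z - x n z) \<le> (1/3) ^ n \<and> cmod (l2_inner (x (Suc n)) (h n)) \<ge> (1/3) ^ n * l2_norm (h n))"
    by (rule dependent_nat_choice) (use step A2_zero in blast)+
  then obtain x where x: "\<And>n. x n \<in> A2" and xs: "\<And>n. l2_norm (\<lambda>z. x (Suc n) z - x n z) \<le> (1/3) ^ n"
    and xh: "\<And>n. cmod (l2_inner (x (Suc n)) (h n)) \<ge> (1/3) ^ n * l2_norm (h n)"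
    by blast
  \<comment> \<open>The exact partial sum of the geometric series, which makes the induction go
    through.\<close>
  have dist: "l2_norm (\<lambda>z. x (n + k) z - x n z) \<le> 3/2 * ((1/3) ^ n - (1/3) ^ (n + k))" for n k
  proof (induction k)
    case 0
    show ?case by (simp add: l2_norm_eq)
  next
    case (Suc k)
    have "l2_norm (\<lambda>z. x (n + Suc k) z - x n z) \<le> l2_norm (\<lambda>z. x (Suc (n + k)) z - x (n + k) z) + l2_norm (\<lambda>z. x (n + k) z - x n z)"
      using l2_norm_triangle_diff[OF A2_L2[OF x] A2_L2[OF x] A2_L2[OF x], of "Suc (n + k)" n "n + k"] by simp
    also have "\<dots> \<le> (1/3) ^ (n + k) + 3/2 * ((1/3) ^ n - (1/3) ^ (n + k))"
      using xs Suc.IH by (intro add_mono)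
    also have "\<dots> = 3/2 * ((1/3) ^ n - (1/3) ^ (n + Suc k))"
      by (simp add: field_simps)
    finally show ?case .
  qed
  have dist': "l2_norm (\<lambda>z. x m z - x n z) \<le> 3/2 * (1/3) ^ n" if "m \<ge> n" for m n
  proof -
    have "l2_norm (\<lambda>z. x m z - x n z) \<le> 3/2 * ((1/3) ^ n - (1/3) ^ m)"
      using dist[of n "m - n"] that by simp
    also have "\<dots> \<le> 3/2 * (1/3) ^ n"
      by simp
    finally show ?thesis .
  qed
  have "l2_Cauchy x"
    unfolding l2_Cauchy_def
  proof (intro allI impI)
    fix e :: real assume e: "e > 0"
    \<comment> \<open>Both \<open>x m\<close> and \<open>x n\<close> then lie within
      \<open>3/2 * (e / 3) = e / 2\<close> of \<open>x N\<close>.\<close>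
    obtain N where N: "(1/3 :: real) ^ N < e / 3"
      using real_arch_pow_inv[of "e / 3" "1/3"] e by auto
    have "l2_norm (\<lambda>z. x m z - x n z) < e" if "m \<ge> N" "n \<ge> N" for m n
      using l2_norm_triangle_diff[OF A2_L2[OF x] A2_L2[OF x] A2_L2[OF x], of m n N]
        dist'[OF that(1)] dist'[OF that(2)] l2_norm_minus_commute[of "x N" "x n"] N by linarith
    then show "\<exists>N. \<forall>m\<ge>N. \<forall>n\<ge>N. l2_norm (\<lambda>z. x m z - x n z) < e"
      by blast
  qed
  then obtain X where X: "X \<in> A2" and lim: "(\<lambda>n. l2_norm (\<lambda>z. x n z - X z)) \<longlonglongrightarrow> 0"
    using A2_complete x unfolding l2_complete_def by blast
  have XD: "l2_norm (\<lambda>z. x n z - X z) \<le> 3/2 * (1/3) ^ n" for n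
  proof (rule LIMSEQ_le_const)
    show "(\<lambda>m. 3/2 * (1/3) ^ n + l2_norm (\<lambda>z. x m z - X z)) \<longlonglongrightarrow> 3/2 * (1/3) ^ n"
      using tendsto_add[OF tendsto_const lim] by simp
    have "l2_norm (\<lambda>z. x n z - X z) \<le> 3/2 * (1/3) ^ n + l2_norm (\<lambda>z. x m z - X z)" if "m \<ge> n" for m
      using l2_norm_triangle_diff[OF A2_L2[OF x] A2_L2[OF x] A2_L2[OF X], of n m] dist'[OF that]
        l2_norm_minus_commute[of "x n" "x m"] by linarith
    then show "\<exists>N. \<forall>m\<ge>N. l2_norm (\<lambda>z. x n z - X z) \<le> 3/2 * (1/3) ^ n + l2_norm (\<lambda>z. x m z - X z)"
      by blast
  qed
  obtain K where K: "\<forall>h\<in>H. cmod (l2_inner X h) \<le> K"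
    using pt[OF X] by blast
  obtain n where n: "real n > K"
    using reals_Archimedean2 by blast
  have "l2_inner (x (Suc n)) (h n) = l2_inner (\<lambda>z. x (Suc n) z - X z) (h n) + l2_inner X (h n)"
    using l2_inner_diff_left[OF A2_L2[OF x] A2_L2[OF X] A2_L2[OF h], of "Suc n" n] by simp
  then have "(1/3) ^ n * l2_norm (h n) \<le> cmod (l2_inner (\<lambda>z. x (Suc n) z - X z) (h n)) + cmod (l2_inner X (h n))"
    using xh[of n] norm_triangle_ineq order_trans by metis
  also have "cmod (l2_inner (\<lambda>z. x (Suc n) z - X z) (h n)) \<le> l2_norm (\<lambda>z. x (Suc n) z - X z) * l2_norm (h n)"
    by (intro l2_cauchy_schwarz A2_L2 A2_diff x X h)
  \<comment> \<open>The hump for \<open>h n\<close> is created at index \<open>Suc n\<close>, and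
    \<open>3/2 * (1/3) ^ Suc n\<close> is half of \<open>(1/3) ^ n\<close>; so passing to the limit
    costs at most half of it.\<close>
  also have "\<dots> \<le> (3/2 * (1/3) ^ Suc n) * l2_norm (h n)"
    by (intro mult_right_mono XD) simp
  finally have "(1/3) ^ n * l2_norm (h n) / 2 \<le> cmod (l2_inner X (h n))"
    by simp
  also have "\<dots> \<le> K"
    using K hH by blast
  finally have "l2_norm (h n) \<le> 2 * K * 3 ^ n"
    by (simp add: field_simps power_divide)
  also have "\<dots> \<le> 2 * real n * 3 ^ n"
    using n by simp
  finally show False
    using hn[of n] by simp
qed

section \<open>Fredholmness and invertibility\<close>

lemma toeplitz_scale:
  assumes "disc_symbol \<phi>" "f \<in> A2" "z \<in> disc"
  shows "toeplitz \<phi> (\<lambda>w. c * f w) z = c * toeplitz \<phi> f z"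
  using toeplitz_lincomb[of \<phi> f f z "c - 1"] assms by (simp add: algebra_simps)

text \<open>The lower bound makes preimages of a Cauchy sequence Cauchy; boundedness of the operator
  carries their limit back to the range.\<close>

lemma toeplitz_range_complete:
  assumes \<phi>: "disc_symbol \<phi>" and C: "\<And>f. f \<in> A2 \<Longrightarrow> l2_norm f \<le> C * l2_norm (toeplitz \<phi> f)"
  shows "l2_complete (toeplitz_range \<phi>)"
  unfolding l2_complete_def
proof (intro allI impI, elim conjE)
  fix g :: "nat \<Rightarrow> complex \<Rightarrow> complex"
  assume g: "\<forall>n. g n \<in> toeplitz_range \<phi>" and Cg: "l2_Cauchy g"
  then obtain f where f: "\<And>n. f n \<in> A2" and fg: "\<And>n z. z \<in> disc \<Longrightarrow> toeplitz \<phi> (f n) z = g n z"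
    unfolding toeplitz_range_def mem_Collect_eq by metis
  have "l2_norm (\<lambda>z. f m z - f n z) \<le> C * l2_norm (\<lambda>z. g m z - g n z)" for m n
  proof -
    have "l2_norm (toeplitz \<phi> (\<lambda>z. f m z - f n z)) = l2_norm (\<lambda>z. g m z - g n z)"
      using f by (intro l2_norm_cong) (simp add: toeplitz_diff[OF \<phi>] fg)
    then show ?thesis
      using C[OF A2_diff[OF f f], of m n] by simp
  qed
  then have le: "l2_norm (\<lambda>z. f m z - f n z) \<le> (\<bar>C\<bar> + 1) * l2_norm (\<lambda>z. g m z - g n z)" for m n
    by (rule order_trans) (intro mult_right_mono, auto)
  have "l2_Cauchy f"
    unfolding l2_Cauchy_def
  proof (intro allI impI)
    fix e :: real assume "e > 0"
    then have "e / (\<bar>C\<bar> + 1) > 0"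
      by (intro divide_pos_pos) auto
    then obtain N where N: "\<forall>m\<ge>N. \<forall>n\<ge>N. l2_norm (\<lambda>z. g m z - g n z) < e / (\<bar>C\<bar> + 1)"
      using Cg unfolding l2_Cauchy_def by blast
    have "l2_norm (\<lambda>z. f m z - f n z) < e" if "m \<ge> N" "n \<ge> N" for m n
    proof -
      have "(\<bar>C\<bar> + 1) * l2_norm (\<lambda>z. g m z - g n z) < e"
        using N that by (simp add: pos_less_divide_eq mult.commute add_nonneg_pos)
      then show ?thesis
        using le[of m n] by linarith
    qed
    then show "\<exists>N. \<forall>m\<ge>N. \<forall>n\<ge>N. l2_norm (\<lambda>z. f m z - f n z) < e"
      by blast
  qed
  then obtain h where h: "h \<in> A2" and lim: "(\<lambda>n. l2_norm (\<lambda>z. f n z - h z)) \<longlonglongrightarrow> 0"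
    using A2_complete f unfolding l2_complete_def by blast
  obtain B where B: "\<And>f. f \<in> A2 \<Longrightarrow> l2_norm (toeplitz \<phi> f) \<le> B * l2_norm f"
    using toeplitz_bounded[OF \<phi>] by blast
  have "l2_norm (\<lambda>z. g n z - toeplitz \<phi> h z) \<le> B * l2_norm (\<lambda>z. f n z - h z)" for n
  proof -
    have "l2_norm (toeplitz \<phi> (\<lambda>z. f n z - h z)) = l2_norm (\<lambda>z. g n z - toeplitz \<phi> h z)"
      using f h by (intro l2_norm_cong) (simp add: toeplitz_diff[OF \<phi>] fg)
    then show ?thesis
      using B[OF A2_diff[OF f h], of n] by simp
  qed
  then have "(\<lambda>n. l2_norm (\<lambda>z. g n z - toeplitz \<phi> h z)) \<longlonglongrightarrow> 0"
    by (intro tendsto_sandwich[OF _ _ tendsto_const tendsto_mult_right_zero[OF lim, of B]]) auto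
  moreover have "toeplitz \<phi> h \<in> toeplitz_range \<phi>"
    using h toeplitz_A2[OF \<phi>] by (auto simp: toeplitz_range_def)
  ultimately show "\<exists>h\<in>toeplitz_range \<phi>. (\<lambda>n. l2_norm (\<lambda>z. g n z - h z)) \<longlonglongrightarrow> 0"
    by blast
qed

text \<open>Writing \<open>g\<close> as \<open>toeplitz \<phi> f\<close> turns the inner product of
  \<open>g\<close> and \<open>h\<close> into that of \<open>f\<close> and the adjoint image of
  \<open>h\<close>. Hence the set of \<open>h\<close> with adjoint image of norm at most 1 is weakly
  bounded, so it is bounded in norm, and scaling gives the estimate.\<close>

lemma toeplitz_adjoint_bounded_below:
  assumes \<phi>: "disc_symbol \<phi>" and surj: "\<And>g. g \<in> A2 \<Longrightarrow> \<exists>f\<in>A2. \<forall>z\<in>disc. toeplitz \<phi> f z = g z"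
  obtains C where "\<And>h. h \<in> A2 \<Longrightarrow> l2_norm h \<le> C * l2_norm (toeplitz (\<lambda>z. cnj (\<phi> z)) h)"
proof -
  let ?S = "toeplitz (\<lambda>z. cnj (\<phi> z))"
  have S: "disc_symbol (\<lambda>z. cnj (\<phi> z))"
    using \<phi> by (rule disc_symbol_cnj)
  have weak: "\<exists>f\<in>A2. \<forall>h\<in>A2. cmod (l2_inner g h) \<le> l2_norm f * l2_norm (?S h)" if g: "g \<in> A2" for g
  proof -
    obtain f where f: "f \<in> A2" "\<And>z. z \<in> disc \<Longrightarrow> toeplitz \<phi> f z = g z"
      using surj[OF g] by blast
    have "cmod (l2_inner g h) \<le> l2_norm f * l2_norm (?S h)" if h: "h \<in> A2" for h
    proof -
      have "l2_inner g h = l2_inner (toeplitz \<phi> f) h"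
        using f(2) by (intro l2_inner_cong) auto
      also have "\<dots> = l2_inner f (?S h)"
        using \<phi> f(1) h by (rule l2_inner_toeplitz_adjoint)
      finally show ?thesis
        using l2_cauchy_schwarz[OF A2_L2[OF f(1)] A2_L2[OF toeplitz_A2[OF S h]]] by simp
    qed
    with f(1) show ?thesis by blast
  qed
  have "\<exists>C. \<forall>h\<in>{h \<in> A2. l2_norm (?S h) \<le> 1}. l2_norm h \<le> C"
  proof (rule A2_uniform_boundedness)
    fix g assume "g \<in> A2"
    then obtain f where f: "\<forall>h\<in>A2. cmod (l2_inner g h) \<le> l2_norm f * l2_norm (?S h)"
      using weak by blast
    have "cmod (l2_inner g h) \<le> l2_norm f" if "h \<in> A2" "l2_norm (?S h) \<le> 1" for h
    proof -
      have "l2_norm f * l2_norm (?S h) \<le> l2_norm f"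
        using that(2) by (simp add: mult_left_le)
      with f that(1) show ?thesis
        using order_trans by blast
    qed
    then show "\<exists>K. \<forall>h\<in>{h \<in> A2. l2_norm (?S h) \<le> 1}. cmod (l2_inner g h) \<le> K"
      by blast
  qed auto
  then obtain C where C: "\<And>h. h \<in> A2 \<Longrightarrow> l2_norm (?S h) \<le> 1 \<Longrightarrow> l2_norm h \<le> C"
    by auto
  have "l2_norm h \<le> C * l2_norm (?S h)" if h: "h \<in> A2" for h
  proof (cases "l2_norm (?S h) = 0")
    \<comment> \<open>Scaling is impossible here; instead \<open>weak\<close> with
      \<open>g = h\<close> shows that \<open>h\<close> has norm zero.\<close>
    case True
    then have "cmod (l2_inner h h) \<le> 0"
      using weak[OF h] h by fastforce
    then show ?thesis
      using True by (simp add: l2_inner_self)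
  next
    case False
    define m where "m = l2_norm (?S h)"
    have m: "m > 0"
      using False by (simp add: m_def order_less_le)
    let ?k = "\<lambda>z. complex_of_real (1 / m) * h z"
    have "l2_norm (?S ?k) = l2_norm (\<lambda>z. complex_of_real (1 / m) * ?S h z)"
      by (intro l2_norm_cong toeplitz_scale S h)
    also have "\<dots> = 1"
      unfolding l2_norm_scale norm_of_real using m by (simp add: m_def)
    finally have "l2_norm ?k \<le> C"
      by (intro C A2_scale h) simp
    then show ?thesis
      unfolding l2_norm_scale norm_of_real using m by (simp add: m_def field_simps)
  qed
  then show ?thesis
    using that by blast
qed

lemma toeplitz_injective:
  assumes "disc_symbol \<phi>" "\<And>f. f \<in> A2 \<Longrightarrow> l2_norm f \<le> C * l2_norm (toeplitz \<phi> f)"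
    and "f \<in> A2" "g \<in> A2" "\<And>z. z \<in> disc \<Longrightarrow> toeplitz \<phi> f z = toeplitz \<phi> g z" "z \<in> disc"
  shows "f z = g z"
proof -
  have d: "(\<lambda>z. f z - g z) \<in> A2"
    using assms A2_diff by blast
  have "l2_norm (toeplitz \<phi> (\<lambda>z. f z - g z)) = l2_norm (\<lambda>z. 0)"
    using assms by (intro l2_norm_cong) (simp add: toeplitz_diff)
  then have "l2_norm (\<lambda>z. f z - g z) \<le> 0"
    using assms(2)[OF d] by (simp add: l2_norm_eq)
  then have "l2_norm (\<lambda>z. f z - g z) = 0"
    using l2_norm_nonneg order_antisym by blast
  from A2_norm_0[OF d this \<open>z \<in> disc\<close>] show ?thesis
    by simp
qed

lemma invertible_A2_imp_fredholm_A2: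
  assumes TA: "\<And>f. f \<in> A2 \<Longrightarrow> T f \<in> A2" and "invertible_A2 T"
  shows "fredholm_A2 T"
proof -
  from assms(2) obtain S where S: "\<And>g. g \<in> A2 \<Longrightarrow> S g \<in> A2"
    and cong: "\<And>g1 g2 z. \<lbrakk>g1 \<in> A2; g2 \<in> A2; \<forall>z\<in>disc. g1 z = g2 z; z \<in> disc\<rbrakk> \<Longrightarrow> S g1 z = S g2 z"
    and lin: "\<And>g1 g2 c z. \<lbrakk>g1 \<in> A2; g2 \<in> A2; z \<in> disc\<rbrakk> \<Longrightarrow> S (\<lambda>w. c * g1 w + g2 w) z = c * S g1 z + S g2 z"
    and ST: "\<And>f z. \<lbrakk>f \<in> A2; z \<in> disc\<rbrakk> \<Longrightarrow> S (T f) z = f z"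
    and TS: "\<And>g z. \<lbrakk>g \<in> A2; z \<in> disc\<rbrakk> \<Longrightarrow> T (S g) z = g z"
    unfolding invertible_A2_def by (elim exE conjE) (rule that; blast)
  have ker: "f z = 0" if "f \<in> A2" "\<forall>z\<in>disc. T f z = 0" "z \<in> disc" for f z
  proof -
    have "f z = S (T f) z"
      using that ST by simp
    \<comment> \<open>The zero function is written as a linear combination so that linearity of
      \<open>S\<close> can be applied to it.\<close>
    also have "\<dots> = S (\<lambda>w. (-1) * T f w + T f w) z"
      using that by (intro cong TA A2_lincomb) auto
    also have "\<dots> = 0"
      using that TA by (subst lin) auto
    finally show ?thesis .
  qed
  show ?thesis
    unfolding fredholm_A2_def
  proof (intro conjI allI impI)
    fix f g assume "(\<forall>n. f n \<in> A2) \<and> g \<in> A2 \<and> (\<lambda>n. l2_norm (\<lambda>z. T (f n) z - g z)) \<longlonglongrightarrow> 0"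
    then show "\<exists>h\<in>A2. \<forall>z\<in>disc. T h z = g z"
      using S TS by blast
  next
    show "\<exists>B. finite B \<and> B \<subseteq> {f \<in> A2. \<forall>z\<in>disc. T f z = 0} \<and>
         (\<forall>f\<in>A2. (\<forall>z\<in>disc. T f z = 0) \<longrightarrow> (\<exists>c. \<forall>z\<in>disc. f z = (\<Sum>b\<in>B. c b * b z)))"
      using ker by (intro exI[of _ "{}"]) auto
    show "\<exists>B. finite B \<and> B \<subseteq> A2 \<and>
         (\<forall>g\<in>A2. \<exists>f\<in>A2. \<exists>c. \<forall>z\<in>disc. g z = T f z + (\<Sum>b\<in>B. c b * b z))"
    proof (intro exI[of _ "{}"] conjI ballI)
      fix g assume "g \<in> A2"
      then show "\<exists>f\<in>A2. \<exists>c. \<forall>z\<in>disc. g z = T f z + (\<Sum>b\<in>{}. c b * b z)"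
        using S TS by (intro bexI[of _ "S g"]) auto
    qed auto
  qed
qed

text \<open>For a symbol vanishing on the disc the operator is zero and its kernel is the whole
  Bergman space, which has no finite spanning set.\<close>

lemma fredholm_toeplitz_symbol_nonzero:
  assumes \<phi>: "disc_symbol \<phi>" and "fredholm_A2 (toeplitz \<phi>)"
  shows "\<exists>z\<in>disc. \<phi> z \<noteq> 0"
proof (rule ccontr)
  assume z: "\<not> ?thesis"
  have T0: "toeplitz \<phi> f z = 0" if "f \<in> A2" "z \<in> disc" for f z
  proof (rule A2_eqI[where f = "toeplitz \<phi> f" and g = "\<lambda>z. 0"])
    fix k assume "k \<in> A2"
    then have "l2_inner (toeplitz \<phi> f) k = l2_inner (\<lambda>z. \<phi> z * f z) k"
      by (rule l2_inner_toeplitz[OF \<phi> that(1)])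
    also have "\<dots> = l2_inner (\<lambda>z. 0) k"
      using z by (intro l2_inner_cong) auto
    finally show "l2_inner (toeplitz \<phi> f) k = l2_inner (\<lambda>z. 0) k" .
  qed (use that \<phi> in \<open>auto simp: A2_zero toeplitz_A2\<close>)
  obtain B where "finite B" "\<forall>f\<in>A2. (\<forall>z\<in>disc. toeplitz \<phi> f z = 0) \<longrightarrow> (\<exists>c. \<forall>z\<in>disc. f z = (\<Sum>b\<in>B. c b * b z))"
    using assms(2) unfolding fredholm_A2_def by blast
  then show False
    using A2_infinite_dimensional[of B] T0 by blast
qed

text \<open>A Cauchy sequence in the range converges in \<open>A2\<close>, and the closed range
  clause of Fredholmness provides a preimage of the limit.\<close>

lemma fredholm_toeplitz_range_complete:
  assumes "fredholm_A2 (toeplitz \<phi>)"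
  shows "l2_complete (toeplitz_range \<phi>)"
  unfolding l2_complete_def
proof (intro allI impI, elim conjE)
  fix g :: "nat \<Rightarrow> complex \<Rightarrow> complex"
  assume g: "\<forall>n. g n \<in> toeplitz_range \<phi>" and "l2_Cauchy g"
  then obtain h where h: "h \<in> A2" and lim: "(\<lambda>n. l2_norm (\<lambda>z. g n z - h z)) \<longlonglongrightarrow> 0"
    using A2_complete unfolding l2_complete_def toeplitz_range_def by blast
  obtain f where f: "\<And>n. f n \<in> A2" and fg: "\<And>n z. z \<in> disc \<Longrightarrow> toeplitz \<phi> (f n) z = g n z"
    using g unfolding toeplitz_range_def mem_Collect_eq by metis
  have "l2_norm (\<lambda>z. toeplitz \<phi> (f n) z - h z) = l2_norm (\<lambda>z. g n z - h z)" for n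
    by (intro l2_norm_cong) (simp add: fg)
  then have "(\<lambda>n. l2_norm (\<lambda>z. toeplitz \<phi> (f n) z - h z)) \<longlonglongrightarrow> 0"
    using lim by simp
  then have "\<exists>k\<in>A2. \<forall>z\<in>disc. toeplitz \<phi> k z = h z"
    using assms f h unfolding fredholm_A2_def by blast
  then have "h \<in> toeplitz_range \<phi>"
    using h by (simp add: toeplitz_range_def)
  with lim show "\<exists>h\<in>toeplitz_range \<phi>. (\<lambda>n. l2_norm (\<lambda>z. g n z - h z)) \<longlonglongrightarrow> 0"
    by blast
qed

text \<open>Choose preimages arbitrarily. The lower bound makes them unique on the disc, which
  yields linearity and compatibility with equality there, and it also bounds the inverse.\<close>

lemma bijective_toeplitz_invertible:
  assumes \<phi>: "disc_symbol \<phi>" and C: "\<And>f. f \<in> A2 \<Longrightarrow> l2_norm f \<le> C * l2_norm (toeplitz \<phi> f)"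
    and surj: "\<And>g. g \<in> A2 \<Longrightarrow> \<exists>f\<in>A2. \<forall>z\<in>disc. toeplitz \<phi> f z = g z"
  shows "invertible_A2 (toeplitz \<phi>)"
proof -
  obtain S where SA: "\<And>g. g \<in> A2 \<Longrightarrow> S g \<in> A2" and TS: "\<And>g z. g \<in> A2 \<Longrightarrow> z \<in> disc \<Longrightarrow> toeplitz \<phi> (S g) z = g z"
    using surj by metis
  note inj = toeplitz_injective[OF \<phi> C]
  show ?thesis
    unfolding invertible_A2_def
  proof (intro exI[of _ S] conjI ballI allI impI)
    fix g1 g2 z assume "g1 \<in> A2" "g2 \<in> A2" "\<forall>z\<in>disc. g1 z = g2 z" "z \<in> disc"
    then show "S g1 z = S g2 z"
      by (intro inj[of "S g1" "S g2"]) (auto simp: SA TS)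
  next
    fix g1 g2 c z assume g: "g1 \<in> A2" "g2 \<in> A2" and z: "z \<in> disc"
    show "S (\<lambda>w. c * g1 w + g2 w) z = c * S g1 z + S g2 z"
      by (rule inj[where g = "\<lambda>z. c * S g1 z + S g2 z"])
        (use g z in \<open>auto simp: SA A2_lincomb TS toeplitz_lincomb[OF \<phi>]\<close>)
  next
    show "\<exists>C. \<forall>g\<in>A2. l2_norm (S g) \<le> C * l2_norm g"
    proof (intro exI ballI)
      fix g assume g: "g \<in> A2"
      have "l2_norm (toeplitz \<phi> (S g)) = l2_norm g"
        using g by (intro l2_norm_cong) (simp add: TS)
      then show "l2_norm (S g) \<le> C * l2_norm g"
        using C[OF SA[OF g]] by simp
    qed
  next
    fix f z assume "f \<in> A2" "z \<in> disc"
    then show "S (toeplitz \<phi> f) z = f z"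
      by (intro inj[of "S (toeplitz \<phi> f)" f]) (auto simp: SA TS toeplitz_A2[OF \<phi>])
  qed (simp_all add: SA TS)
qed

theorem theorem5p6:
  fixes \<phi> :: "complex \<Rightarrow> complex"
  assumes "continuous_on (cball 0 1) \<phi>"
    and "\<phi> \<in> AQ"
    and "\<forall>z\<in>disc. Re (\<phi> z) \<ge> \<bar>Im (\<phi> z)\<bar>\<^sup>2"
  shows "invertible_A2 (toeplitz \<phi>) \<longleftrightarrow> fredholm_A2 (toeplitz \<phi>)"
proof
  have disc_sub: "disc \<subseteq> cball 0 1"
    by (auto simp: disc_def)
  have "bounded (\<phi> ` cball 0 1)"
    by (intro compact_imp_bounded compact_continuous_image assms) simp
  then have \<phi>: "disc_symbol \<phi>"
    using continuous_on_subset[OF assms(1) disc_sub] disc_sub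
    by (force simp: disc_symbol_def bounded_iff)
  {
    assume "invertible_A2 (toeplitz \<phi>)"
    then show "fredholm_A2 (toeplitz \<phi>)"
      using invertible_A2_imp_fredholm_A2 toeplitz_A2[OF \<phi>] by blast
  }
  assume fred: "fredholm_A2 (toeplitz \<phi>)"
  let ?\<psi> = "\<lambda>z. cnj (\<phi> z)"
  have \<psi>: "disc_symbol ?\<psi>"
    using \<phi> by (rule disc_symbol_cnj)
  obtain z0 where z0: "z0 \<in> disc" "\<phi> z0 \<noteq> 0"
    using fredholm_toeplitz_symbol_nonzero[OF \<phi> fred] by blast
  \<comment> \<open>Conjugation keeps the real part and only changes the sign of the imaginary
    part.\<close>
  have acc: "Re (\<phi> z) \<ge> \<bar>Im (\<phi> z)\<bar>\<^sup>2" "Re (?\<psi> z) \<ge> \<bar>Im (?\<psi> z)\<bar>\<^sup>2" if "z \<in> disc" for z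
    using assms(3) that by auto
  have surj: "\<exists>f\<in>A2. \<forall>z\<in>disc. toeplitz \<phi> f z = g z" if "g \<in> A2" for g
    using toeplitz_surj[OF \<phi> acc(1) z0 fredholm_toeplitz_range_complete[OF fred] that] .
  obtain C where C: "\<And>h. h \<in> A2 \<Longrightarrow> l2_norm h \<le> C * l2_norm (toeplitz ?\<psi> h)"
    using toeplitz_adjoint_bounded_below[OF \<phi> surj] by blast
  \<comment> \<open>The lower bound for the adjoint makes its range complete, and accretivity of the
    conjugate symbol upgrades this to surjectivity.\<close>
  have "\<exists>f\<in>A2. \<forall>z\<in>disc. toeplitz ?\<psi> f z = g z" if "g \<in> A2" for g
    using toeplitz_surj[OF \<psi> acc(2) z0(1) _ toeplitz_range_complete[OF \<psi> C] that] z0(2) by simp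
  \<comment> \<open>The same duality for the conjugate symbol; conjugating twice returns
    \<open>\<phi>\<close>.\<close>
  from toeplitz_adjoint_bounded_below[OF \<psi> this]
  obtain C' where "\<And>h. h \<in> A2 \<Longrightarrow> l2_norm h \<le> C' * l2_norm (toeplitz \<phi> h)"
    by auto
  then show "invertible_A2 (toeplitz \<phi>)"
    by (rule bijective_toeplitz_invertible[OF \<phi> _ surj])
qed

end
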